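(* Let $\mu$ be an arbitrary measure and let $\nu$ be a localizable measure. Then the pair $(L_1(\mu),L_\infty(\nu))$ has the Bishop-Phelps-Bollobás property. Moreover, $$\eta\bigl(L_1(\mu),L_\infty(\nu)\bigr)(\varepsilon)\geq\left(\frac{\varepsilon}{10}\right)^8\qquad(0<\varepsilon<1).$$
   Context: Banach spaces are over a fixed scalar field $\mathbb{K}=\mathbb{R}$ or $\mathbb{C}$ (the result is for both cases). $S_X$ is the unit sphere of $X$; $\mathcal{L}(X,Y)$ is the space of bounded linear operators from $X$ to $Y$ with the operator norm. A pair $(X,Y)$ of Banach spaces has the Bishop-Phelps-Bollobás property (BPBp) if for every $0<\varepsilon<1$ there is $\eta(\varepsilon)>0$ such that for every $T\in\mathcal{L}(X,Y)$ with $\|T\|=1$ and every $x_0\in S_X$ with $\|T(x_0)\|>1-\eta(\varepsilon)$, there exist $y_0\in S_X$ and $S\in\mathcal{L}(X,Y)$ with $\|S\|=1$, $\|Sy_0\|=1$, $\|y_0-x_0\|<\varepsilon$ and $\|S-T\|<\varepsilon$. Put $\Pi(X,Y)=\{(x,T)\in X\times\mathcal{L}(X,Y): \|T\|=\|x\|=\|Tx\|=1\}$ and, for $0<\varepsilon<1$, $$\eta(X,Y)(\varepsilon)=\inf\{1-\|Tx\| : x\in S_X,\ T\in\mathcal{L}(X,Y),\ \|T\|=1,\ \operatorname{dist}((x,T),\Pi(X,Y))\geq\varepsilon\},$$ where $\operatorname{dist}((x,T),\Pi(X,Y))=\inf\{\max\{\|x-y\|,\|T-S\|\}:(y,S)\in\Pi(X,Y)\}$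 (with $\inf\emptyset=+\infty$). The pair $(X,Y)$ has the BPBp if and only if $\eta(X,Y)(\varepsilon)>0$ for all $0<\varepsilon<1$. A measure is localizable (standard notion) if it is semifinite (every measurable set of infinite measure contains a measurable subset of finite positive measure) and every family of measurable sets has an essential supremum (a least upper bound in the measure algebra). *)

theory Defs
  imports "HOL-Probability.Essential_Supremum"
begin

section \<open>Normed spaces on a carrier set\<close>

text \<open>
  The spaces \<open>L\<^sub>1(\<mu>)\<close> and \<open>L\<^sub>\<infinity>(\<nu>)\<close> depend on a measure, which is a term, so they cannot be types of
  class \<^class>\<open>banach\<close>. They are records with an explicit carrier, over a scalar type \<open>'k\<close> that is
  instantiated by \<^typ>\<open>real\<close> or \<^typ>\<open>complex\<close>.
\<close>

record ('k, 'v) nspace =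
  carr :: "'v set"
  vzero :: "'v"
  vadd :: "'v \<Rightarrow> 'v \<Rightarrow> 'v"
  vscale :: "'k \<Rightarrow> 'v \<Rightarrow> 'v"
  vnorm :: "'v \<Rightarrow> real"

definition vdiff :: "('k::real_normed_field, 'v) nspace \<Rightarrow> 'v \<Rightarrow> 'v \<Rightarrow> 'v" where
  "vdiff X x y = vadd X x (vscale X (-1) y)"

definition vdist :: "('k::real_normed_field, 'v) nspace \<Rightarrow> 'v \<Rightarrow> 'v \<Rightarrow> real" where
  "vdist X x y = vnorm X (vdiff X x y)"

locale normed_nspace =
  fixes X :: "('k::real_normed_field, 'v) nspace"
  assumes zero_closed: "vzero X \<in> carr X"
    and add_closed: "\<lbrakk>x \<in> carr X; y \<in> carr X\<rbrakk> \<Longrightarrow> vadd X x y \<in> carr X"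
    and scale_closed: "x \<in> carr X \<Longrightarrow> vscale X c x \<in> carr X"
    and add_assoc: "\<lbrakk>x \<in> carr X; y \<in> carr X; z \<in> carr X\<rbrakk>
      \<Longrightarrow> vadd X (vadd X x y) z = vadd X x (vadd X y z)"
    and add_commute: "\<lbrakk>x \<in> carr X; y \<in> carr X\<rbrakk> \<Longrightarrow> vadd X x y = vadd X y x"
    and add_zero: "x \<in> carr X \<Longrightarrow> vadd X x (vzero X) = x"
    and diff_self: "x \<in> carr X \<Longrightarrow> vdiff X x x = vzero X"
    and scale_add: "\<lbrakk>x \<in> carr X; y \<in> carr X\<rbrakk>
      \<Longrightarrow> vscale X c (vadd X x y) = vadd X (vscale X c x) (vscale X c y)"
    and add_scale: "x \<in> carr X \<Longrightarrow> vscale X (c + d) x = vadd X (vscale X c x) (vscale X d x)"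
    and scale_scale: "x \<in> carr X \<Longrightarrow> vscale X c (vscale X d x) = vscale X (c * d) x"
    and scale_one: "x \<in> carr X \<Longrightarrow> vscale X 1 x = x"
    and norm_nonneg: "x \<in> carr X \<Longrightarrow> 0 \<le> vnorm X x"
    and norm_eq_zero: "x \<in> carr X \<Longrightarrow> vnorm X x = 0 \<longleftrightarrow> x = vzero X"
    and norm_scale: "x \<in> carr X \<Longrightarrow> vnorm X (vscale X c x) = norm c * vnorm X x"
    and norm_triangle: "\<lbrakk>x \<in> carr X; y \<in> carr X\<rbrakk>
      \<Longrightarrow> vnorm X (vadd X x y) \<le> vnorm X x + vnorm X y"

locale banach_nspace = normed_nspace X for X :: "('k::real_normed_field, 'v) nspace" +
  assumes complete: "\<lbrakk>\<And>n. s n \<in> carr X;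
      \<And>e. 0 < e \<Longrightarrow> \<exists>N. \<forall>m\<ge>N. \<forall>n\<ge>N. vdist X (s m) (s n) < e\<rbrakk>
    \<Longrightarrow> \<exists>l\<in>carr X. (\<lambda>n. vdist X (s n) l) \<longlonglongrightarrow> 0"

definition unit_sphere :: "('k::real_normed_field, 'v) nspace \<Rightarrow> 'v set" where
  "unit_sphere X = {x \<in> carr X. vnorm X x = 1}"


section \<open>Bounded linear operators\<close>

text \<open>Operators are \<^const>\<open>extensional\<close> outside the carrier, so that equal operators are equal functions.\<close>

definition bounded_ops ::
    "('k::real_normed_field, 'v) nspace \<Rightarrow> ('k, 'w) nspace \<Rightarrow> ('v \<Rightarrow> 'w) set" where
  "bounded_ops X Y = {T \<in> carr X \<rightarrow>\<^sub>E carr Y.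
     (\<forall>x\<in>carr X. \<forall>y\<in>carr X. T (vadd X x y) = vadd Y (T x) (T y)) \<and>
     (\<forall>c. \<forall>x\<in>carr X. T (vscale X c x) = vscale Y c (T x)) \<and>
     (\<exists>K. \<forall>x\<in>carr X. vnorm Y (T x) \<le> K * vnorm X x)}"

definition op_norm ::
    "('k::real_normed_field, 'v) nspace \<Rightarrow> ('k, 'w) nspace \<Rightarrow> ('v \<Rightarrow> 'w) \<Rightarrow> real" where
  "op_norm X Y T = (SUP x\<in>{x \<in> carr X. vnorm X x \<le> 1}. vnorm Y (T x))"

definition op_dist ::
    "('k::real_normed_field, 'v) nspace \<Rightarrow> ('k, 'w) nspace \<Rightarrow> ('v \<Rightarrow> 'w) \<Rightarrow> ('v \<Rightarrow> 'w) \<Rightarrow> real" where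
  "op_dist X Y S T = op_norm X Y (\<lambda>x\<in>carr X. vdiff Y (S x) (T x))"


section \<open>The Bishop-Phelps-Bollobas property and its modulus\<close>

definition BPBp :: "('k::real_normed_field, 'v) nspace \<Rightarrow> ('k, 'w) nspace \<Rightarrow> bool" where
  "BPBp X Y \<longleftrightarrow> (\<forall>\<epsilon>. 0 < \<epsilon> \<and> \<epsilon> < 1 \<longrightarrow> (\<exists>\<eta>>0.
     \<forall>T\<in>bounded_ops X Y. op_norm X Y T = 1 \<longrightarrow>
       (\<forall>x0\<in>unit_sphere X. vnorm Y (T x0) > 1 - \<eta> \<longrightarrow>
         (\<exists>y0\<in>unit_sphere X. \<exists>S\<in>bounded_ops X Y.
            op_norm X Y S = 1 \<and> vnorm Y (S y0) = 1 \<and>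
            vdist X y0 x0 < \<epsilon> \<and> op_dist X Y S T < \<epsilon>))))"

definition norming_pairs ::
    "('k::real_normed_field, 'v) nspace \<Rightarrow> ('k, 'w) nspace \<Rightarrow> ('v \<times> ('v \<Rightarrow> 'w)) set" where
  "norming_pairs X Y = {(x, T). x \<in> carr X \<and> T \<in> bounded_ops X Y \<and>
     op_norm X Y T = 1 \<and> vnorm X x = 1 \<and> vnorm Y (T x) = 1}"

text \<open>Both infima are taken in \<^typ>\<open>ereal\<close>, where the infimum of the empty set is \<open>\<infinity>\<close>.\<close>

definition dist_norming_pairs ::
    "('k::real_normed_field, 'v) nspace \<Rightarrow> ('k, 'w) nspace \<Rightarrow> 'v \<Rightarrow> ('v \<Rightarrow> 'w) \<Rightarrow> ereal" where
  "dist_norming_pairs X Y x T =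
     (INF (y, S)\<in>norming_pairs X Y. ereal (max (vdist X x y) (op_dist X Y T S)))"

definition BPB_modulus ::
    "('k::real_normed_field, 'v) nspace \<Rightarrow> ('k, 'w) nspace \<Rightarrow> real \<Rightarrow> ereal" where
  "BPB_modulus X Y \<epsilon> = Inf {ereal (1 - vnorm Y (T x)) | x T.
     x \<in> unit_sphere X \<and> T \<in> bounded_ops X Y \<and> op_norm X Y T = 1 \<and>
     dist_norming_pairs X Y x T \<ge> ereal \<epsilon>}"


section \<open>The spaces of integrable and of essentially bounded functions\<close>

definition ae_class :: "'a measure \<Rightarrow> ('a \<Rightarrow> 'k::real_normed_field) \<Rightarrow> ('a \<Rightarrow> 'k) set" where
  "ae_class M f = {g \<in> borel_measurable M. AE x in M. g x = f x}"

definition rep :: "('a \<Rightarrow> 'k) set \<Rightarrow> 'a \<Rightarrow> 'k" where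
  "rep A = (SOME f. f \<in> A)"

text \<open>The operations are computed on chosen representatives; the lemmas below show that the choice
  does not matter and that both spaces are Banach spaces.\<close>

definition ae_space :: "'a measure \<Rightarrow> ('a \<Rightarrow> 'k::real_normed_field) set \<Rightarrow> (('a \<Rightarrow> 'k) \<Rightarrow> real)
    \<Rightarrow> ('k, ('a \<Rightarrow> 'k) set) nspace" where
  "ae_space M F p =
     \<lparr>carr = ae_class M ` F,
      vzero = ae_class M (\<lambda>_. 0),
      vadd = (\<lambda>A B. ae_class M (\<lambda>x. rep A x + rep B x)),
      vscale = (\<lambda>c A. ae_class M (\<lambda>x. c * rep A x)),
      vnorm = (\<lambda>A. p (rep A))\<rparr>"

definition L1_norm :: "'a measure \<Rightarrow> ('a \<Rightarrow> 'k::real_normed_field) \<Rightarrow> real" where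
  "L1_norm M f = (\<integral>x. norm (f x) \<partial>M)"

definition Linf_norm :: "'a measure \<Rightarrow> ('a \<Rightarrow> 'k::real_normed_field) \<Rightarrow> real" where
  "Linf_norm M f = enn2real (esssup M (\<lambda>x. ennreal (norm (f x))))"

text \<open>The first argument of \<open>L1\<close> and \<open>Linf\<close> is the scalar field.\<close>

definition L1 :: "'k itself \<Rightarrow> 'a measure
    \<Rightarrow> ('k::{real_normed_field, banach, second_countable_topology}, ('a \<Rightarrow> 'k) set) nspace" where
  "L1 _ M = ae_space M {f. integrable M f} (L1_norm M)"

definition Linf :: "'k itself \<Rightarrow> 'a measure
    \<Rightarrow> ('k::{real_normed_field, banach, second_countable_topology}, ('a \<Rightarrow> 'k) set) nspace" where
  "Linf _ M = ae_space M
     {f \<in> borel_measurable M. esssup M (\<lambda>x. ennreal (norm (f x))) < \<infinity>} (Linf_norm M)"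

lemma rep_ae_class:
  assumes "f \<in> borel_measurable M"
  shows "rep (ae_class M f) \<in> borel_measurable M" "AE x in M. rep (ae_class M f) x = f x"
proof -
  have "f \<in> ae_class M f"
    using assms by (auto simp: ae_class_def)
  then have "rep (ae_class M f) \<in> ae_class M f"
    unfolding rep_def by (rule someI[of "\<lambda>g. g \<in> ae_class M f"])
  then show "rep (ae_class M f) \<in> borel_measurable M" "AE x in M. rep (ae_class M f) x = f x"
    by (auto simp: ae_class_def)
qed

lemma ae_class_cong:
  assumes "AE x in M. f x = g x"
  shows "ae_class M f = ae_class M g"
  using assms unfolding ae_class_def by (auto elim: eventually_elim2)

lemma ae_class_eq_iff:
  assumes "f \<in> borel_measurable M" "g \<in> borel_measurable M"
  shows "ae_class M f = ae_class M g \<longleftrightarrow> (AE x in M. f x = g x)"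
proof
  assume "ae_class M f = ae_class M g"
  moreover have "f \<in> ae_class M f"
    using assms by (auto simp: ae_class_def)
  ultimately show "AE x in M. f x = g x"
    by (auto simp: ae_class_def)
qed (rule ae_class_cong)

locale ae_seminorm =
  fixes M :: "'a measure"
    and F :: "('a \<Rightarrow> 'k::{real_normed_field, banach, second_countable_topology}) set"
    and p :: "('a \<Rightarrow> 'k) \<Rightarrow> real"
  assumes F_measurable: "f \<in> F \<Longrightarrow> f \<in> borel_measurable M"
    and F_zero: "(\<lambda>_. 0) \<in> F"
    and F_add: "\<lbrakk>f \<in> F; g \<in> F\<rbrakk> \<Longrightarrow> (\<lambda>x. f x + g x) \<in> F"
    and F_scale: "f \<in> F \<Longrightarrow> (\<lambda>x. c * f x) \<in> F"
    and p_cong: "\<lbrakk>f \<in> borel_measurable M; g \<in> borel_measurable M; AE x in M. f x = g x\<rbrakk> \<Longrightarrow> p f = p g"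
    and p_nonneg: "f \<in> F \<Longrightarrow> 0 \<le> p f"
    and p_zero: "p (\<lambda>_. 0) = 0"
    and p_eq_zero: "\<lbrakk>f \<in> F; p f = 0\<rbrakk> \<Longrightarrow> AE x in M. f x = 0"
    and p_scale: "f \<in> F \<Longrightarrow> p (\<lambda>x. c * f x) = norm c * p f"
    and p_triangle: "\<lbrakk>f \<in> F; g \<in> F\<rbrakk> \<Longrightarrow> p (\<lambda>x. f x + g x) \<le> p f + p g"
    and p_series: "\<And>f. \<lbrakk>\<And>i::nat. f i \<in> F; summable (\<lambda>i. p (f i))\<rbrakk> \<Longrightarrow>
      \<exists>g\<in>F. \<forall>n. p (\<lambda>x. g x - (\<Sum>i<n. f i x)) \<le> (\<Sum>i. p (f (i + n)))"
begin

abbreviation "Q \<equiv> ae_space M F p"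

lemma carr_Q: "carr Q = ae_class M ` F"
  by (simp add: ae_space_def)

lemma zero_Q: "vzero Q = ae_class M (\<lambda>_. 0)"
  by (simp add: ae_space_def)

lemma add_class:
  assumes "f \<in> F" "g \<in> F"
  shows "vadd Q (ae_class M f) (ae_class M g) = ae_class M (\<lambda>x. f x + g x)"
  using rep_ae_class(2)[OF F_measurable[OF assms(1)]] rep_ae_class(2)[OF F_measurable[OF assms(2)]]
  unfolding ae_space_def by (auto intro!: ae_class_cong)

lemma scale_class:
  assumes "f \<in> F"
  shows "vscale Q c (ae_class M f) = ae_class M (\<lambda>x. c * f x)"
  using rep_ae_class(2)[OF F_measurable[OF assms]]
  unfolding ae_space_def by (auto intro!: ae_class_cong)

lemma norm_class:
  assumes "f \<in> F"
  shows "vnorm Q (ae_class M f) = p f"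
  using rep_ae_class[OF F_measurable[OF assms]] F_measurable[OF assms]
  unfolding ae_space_def by (auto intro!: p_cong)

lemma F_diff:
  assumes "f \<in> F" "g \<in> F"
  shows "(\<lambda>x. f x - g x) \<in> F"
  using F_add[OF assms(1) F_scale[OF assms(2), of "-1"]] by simp

lemma diff_class:
  assumes "f \<in> F" "g \<in> F"
  shows "vdiff Q (ae_class M f) (ae_class M g) = ae_class M (\<lambda>x. f x - g x)"
  using add_class[OF assms(1) F_scale[OF assms(2), of "-1"]] scale_class[OF assms(2), of "-1"]
  by (simp add: vdiff_def)

lemma dist_class:
  assumes "f \<in> F" "g \<in> F"
  shows "vdist Q (ae_class M f) (ae_class M g) = p (\<lambda>x. f x - g x)"
  using assms by (simp add: vdist_def diff_class norm_class F_diff)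

lemma p_diff_commute:
  assumes "f \<in> F" "g \<in> F"
  shows "p (\<lambda>x. f x - g x) = p (\<lambda>x. g x - f x)"
  using p_scale[OF F_diff[OF assms], of "-1"] by simp

lemma p_diff_triangle:
  assumes "f \<in> F" "g \<in> F" "h \<in> F"
  shows "p (\<lambda>x. f x - h x) \<le> p (\<lambda>x. f x - g x) + p (\<lambda>x. g x - h x)"
  using p_triangle[OF F_diff[OF assms(1,2)] F_diff[OF assms(2,3)]] by simp

lemma normed: "normed_nspace Q"
proof
  fix x y z c d
  show "vzero Q \<in> carr Q"
    using F_zero by (auto simp: carr_Q zero_Q)
  assume "x \<in> carr Q"
  then obtain f where f [simp]: "f \<in> F" and x: "x = ae_class M f"
    by (auto simp: carr_Q)
  show "vscale Q c x \<in> carr Q"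
    by (auto simp: x scale_class carr_Q F_scale)
  show "vadd Q x (vzero Q) = x"
    by (simp add: x zero_Q add_class F_zero)
  show "vdiff Q x x = vzero Q"
    by (simp add: x zero_Q diff_class)
  show "vscale Q (c + d) x = vadd Q (vscale Q c x) (vscale Q d x)"
    by (simp add: x scale_class add_class F_scale distrib_right)
  show "vscale Q c (vscale Q d x) = vscale Q (c * d) x"
    by (simp add: x scale_class F_scale mult.assoc)
  show "vscale Q 1 x = x"
    by (simp add: x scale_class)
  show "0 \<le> vnorm Q x"
    by (simp add: x norm_class p_nonneg)
  have "AE x in M. f x = 0" if "p f = 0"
    using f that by (rule p_eq_zero)
  moreover have "p f = 0" if "AE x in M. f x = 0"
    using p_cong[OF F_measurable[OF f] _ that] by (simp add: p_zero)
  ultimately show "vnorm Q x = 0 \<longleftrightarrow> x = vzero Q"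
    by (auto simp: x zero_Q norm_class ae_class_eq_iff F_measurable)
  show "vnorm Q (vscale Q c x) = norm c * vnorm Q x"
    by (simp add: x norm_class scale_class F_scale p_scale)
  assume "y \<in> carr Q"
  then obtain g where g [simp]: "g \<in> F" and y: "y = ae_class M g"
    by (auto simp: carr_Q)
  show "vadd Q x y \<in> carr Q"
    by (auto simp: x y add_class carr_Q F_add)
  show "vadd Q x y = vadd Q y x"
    by (simp add: x y add_class add.commute)
  show "vscale Q c (vadd Q x y) = vadd Q (vscale Q c x) (vscale Q c y)"
    by (simp add: x y scale_class add_class F_scale F_add distrib_left)
  show "vnorm Q (vadd Q x y) \<le> vnorm Q x + vnorm Q y"
    by (simp add: x y norm_class add_class F_add p_triangle)
  assume "z \<in> carr Q"
  then obtain h where h [simp]: "h \<in> F" and z: "z = ae_class M h"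
    by (auto simp: carr_Q)
  show "vadd Q (vadd Q x y) z = vadd Q x (vadd Q y z)"
    by (simp add: x y z add_class F_add add.assoc)
qed

lemma complete_F:
  assumes u: "\<And>n. u n \<in> F"
    and Cauchy: "\<And>e. 0 < e \<Longrightarrow> \<exists>N. \<forall>m\<ge>N. \<forall>n\<ge>N. p (\<lambda>x. u m x - u n x) < e"
  shows "\<exists>g\<in>F. (\<lambda>n. p (\<lambda>x. u n x - g x)) \<longlonglongrightarrow> 0"
proof -
  have "\<forall>k. \<exists>N. \<forall>m\<ge>N. \<forall>n\<ge>N. p (\<lambda>x. u m x - u n x) < (1/2::real) ^ k"
    using Cauchy by simp
  then obtain N where N: "\<And>k m n. \<lbrakk>m \<ge> N k; n \<ge> N k\<rbrakk> \<Longrightarrow> p (\<lambda>x. u m x - u n x) < (1/2::real) ^ k"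
    by metis
  define r where "r k = (\<Sum>i\<le>k. N i)" for k
  have r_ge: "r k \<ge> N k" for k
    unfolding r_def by (rule member_le_sum) auto
  have r_mono: "r (Suc k) \<ge> r k" for k
    unfolding r_def by simp
  define f where "f i x = u (r (Suc i)) x - u (r i) x" for i x
  have f: "f i \<in> F" for i
    unfolding f_def[abs_def] by (intro F_diff u)
  have pf: "p (f i) \<le> (1/2) ^ i" for i
    unfolding f_def[abs_def] using N[of i "r (Suc i)" "r i"] r_ge[of i] r_mono[of i] by simp
  have summable: "summable (\<lambda>i. p (f i))"
    by (rule summable_comparison_test[of _ "\<lambda>i. (1/2::real) ^ i"]) (use pf p_nonneg[OF f] in auto)
  from p_series[OF f summable] obtain g where g: "g \<in> F"
    and g_le: "\<And>n. p (\<lambda>x. g x - (\<Sum>i<n. f i x)) \<le> (\<Sum>i. p (f (i + n)))"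
    by blast
  define h where "h x = u (r 0) x + g x" for x
  have h: "h \<in> F"
    unfolding h_def[abs_def] by (intro F_add u g)
  have sum_f: "(\<Sum>i<n. f i x) = u (r n) x - u (r 0) x" for n x
    unfolding f_def by (induction n) auto
  have tail: "(\<lambda>n. \<Sum>i. p (f (i + n))) \<longlonglongrightarrow> 0"
    by (rule suminf_exist_split2[OF summable])
  have sub: "p (\<lambda>x. u (r n) x - h x) \<le> (\<Sum>i. p (f (i + n)))" for n
  proof -
    have "p (\<lambda>x. u (r n) x - h x) = p (\<lambda>x. h x - u (r n) x)"
      by (rule p_diff_commute[OF u h])
    also have "\<dots> = p (\<lambda>x. g x - (\<Sum>i<n. f i x))"
      by (simp add: sum_f h_def algebra_simps)
    finally show ?thesis using g_le[of n] by simp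
  qed
  have "(\<lambda>n. p (\<lambda>x. u n x - h x)) \<longlonglongrightarrow> 0"
  proof (rule LIMSEQ_I)
    fix e :: real assume "0 < e"
    then have "0 < e / 2" by simp
    from Cauchy[OF this] obtain K where
      K: "\<And>m n. \<lbrakk>m \<ge> K; n \<ge> K\<rbrakk> \<Longrightarrow> p (\<lambda>x. u m x - u n x) < e / 2"
      by blast
    obtain k0 where k0: "\<And>k. k \<ge> k0 \<Longrightarrow> norm ((\<Sum>i. p (f (i + k))) - 0) < e / 2"
      using LIMSEQ_D[OF tail \<open>0 < e / 2\<close>] by blast
    obtain k1 where k1: "(1/2::real) ^ k1 < e / 2"
      using real_arch_pow_inv[OF \<open>0 < e / 2\<close>, of "1/2"] by auto
    define k where "k = max k0 k1"
    have k: "(1/2::real) ^ k \<le> (1/2) ^ k1"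
      unfolding k_def by (rule power_decreasing) auto
    show "\<exists>n0. \<forall>n\<ge>n0. norm (p (\<lambda>x. u n x - h x) - 0) < e"
    proof (intro exI[of _ "r k"] allI impI)
      fix n assume n: "n \<ge> r k"
      have "p (\<lambda>x. u n x - h x) \<le> p (\<lambda>x. u n x - u (r k) x) + p (\<lambda>x. u (r k) x - h x)"
        by (rule p_diff_triangle[OF u u h])
      also have "p (\<lambda>x. u n x - u (r k) x) < e / 2"
        using order.strict_trans2[OF N[of k n "r k"] k] n r_ge[of k] k1 by linarith
      also have "p (\<lambda>x. u (r k) x - h x) < e / 2"
        using sub[of k] k0[of k] by (simp add: k_def)
      finally show "norm (p (\<lambda>x. u n x - h x) - 0) < e"
        using p_nonneg[OF F_diff[OF u h]] by simp
    qed
  qed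
  with h show ?thesis by blast
qed

lemma banach: "banach_nspace Q"
proof (intro banach_nspace.intro normed banach_nspace_axioms.intro)
  fix s assume s: "\<And>n::nat. s n \<in> carr Q"
    and C: "\<And>e. 0 < e \<Longrightarrow> \<exists>N. \<forall>m\<ge>N. \<forall>n\<ge>N. vdist Q (s m) (s n) < e"
  have "\<exists>f. f \<in> F \<and> s n = ae_class M f" for n
    using s[of n] by (auto simp: carr_Q)
  then obtain u where u: "\<And>n. u n \<in> F" and su: "\<And>n. s n = ae_class M (u n)"
    by metis
  have "\<exists>g\<in>F. (\<lambda>n. p (\<lambda>x. u n x - g x)) \<longlonglongrightarrow> 0"
    using C by (intro complete_F u) (simp add: su dist_class u)
  then show "\<exists>l\<in>carr Q. (\<lambda>n. vdist Q (s n) l) \<longlonglongrightarrow> 0"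
    by (auto simp: carr_Q su dist_class u)
qed

end

lemma ae_seminorm_L1:
  "ae_seminorm M
     {f :: 'a \<Rightarrow> 'k::{real_normed_field, banach, second_countable_topology}. integrable M f} (L1_norm M)"
proof
  fix f g :: "'a \<Rightarrow> 'k"
  show "L1_norm M f = L1_norm M g"
    if [measurable]: "f \<in> borel_measurable M" "g \<in> borel_measurable M" and "AE x in M. f x = g x"
    unfolding L1_norm_def using that(3) by (intro integral_cong_AE) auto
next
  fix f :: "'a \<Rightarrow> 'k"
  assume "f \<in> {f. integrable M f}" "L1_norm M f = 0"
  then show "AE x in M. f x = 0"
    using integral_nonneg_eq_0_iff_AE[of M "\<lambda>x. norm (f x)"] by (auto simp: L1_norm_def)
next
  fix f g :: "'a \<Rightarrow> 'k"
  assume fg: "f \<in> {f. integrable M f}" "g \<in> {f. integrable M f}"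
  then have "(\<integral>x. norm (f x + g x) \<partial>M) \<le> (\<integral>x. norm (f x) + norm (g x) \<partial>M)"
    by (intro integral_mono) (auto intro: norm_triangle_ineq)
  also have "\<dots> = (\<integral>x. norm (f x) \<partial>M) + (\<integral>x. norm (g x) \<partial>M)"
    using fg by simp
  finally show "L1_norm M (\<lambda>x. f x + g x) \<le> L1_norm M f + L1_norm M g"
    by (simp add: L1_norm_def)
next
  fix f :: "nat \<Rightarrow> 'a \<Rightarrow> 'k"
  assume "\<And>i. f i \<in> {f. integrable M f}" and sum: "summable (\<lambda>i. L1_norm M (f i))"
  then have int: "\<And>i. integrable M (f i)" by simp
  note [measurable] = borel_measurable_integrable[OF int]
  have "(\<integral>\<^sup>+x. (\<Sum>i. ennreal (norm (f i x))) \<partial>M) = (\<Sum>i. \<integral>\<^sup>+x. ennreal (norm (f i x)) \<partial>M)"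
    by (rule nn_integral_suminf) simp
  also have "\<dots> = (\<Sum>i. ennreal (L1_norm M (f i)))"
    unfolding L1_norm_def using int by (intro suminf_cong nn_integral_eq_integral) auto
  also have "\<dots> = ennreal (\<Sum>i. L1_norm M (f i))"
    by (intro suminf_ennreal2 sum) (simp add: L1_norm_def)
  also have "\<dots> \<noteq> \<infinity>" by simp
  finally have "AE x in M. (\<Sum>i. ennreal (norm (f i x))) \<noteq> \<infinity>"
    by (intro nn_integral_noteq_infinite) auto
  then have ae: "AE x in M. summable (\<lambda>i. norm (f i x))"
    by (auto elim!: eventually_mono intro: summable_suminf_not_top)
  define g where "g x = (\<Sum>i. f i x)" for x
  have g: "integrable M g"
    unfolding g_def[abs_def] using int ae sum by (intro integrable_suminf) (auto simp: L1_norm_def)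
  have "L1_norm M (\<lambda>x. g x - (\<Sum>i<n. f i x)) \<le> (\<Sum>i. L1_norm M (f (i + n)))" for n
  proof -
    have ae': "AE x in M. summable (\<lambda>i. norm (f (i + n) x))"
      using ae by eventually_elim (rule summable_ignore_initial_segment)
    have sum': "summable (\<lambda>i. \<integral>x. norm (f (i + n) x) \<partial>M)"
      using summable_ignore_initial_segment[OF sum, of n] by (simp add: L1_norm_def)
    have int': "integrable M (\<lambda>x. \<Sum>i. norm (f (i + n) x))"
      using int ae' sum' by (intro integrable_suminf) auto
    have "L1_norm M (\<lambda>x. g x - (\<Sum>i<n. f i x)) \<le> (\<integral>x. (\<Sum>i. norm (f (i + n) x)) \<partial>M)"
      unfolding L1_norm_def
    proof (rule integral_mono_AE)
      show "integrable M (\<lambda>x. norm (g x - (\<Sum>i<n. f i x)))"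
        using g int by simp
      show "AE x in M. norm (g x - (\<Sum>i<n. f i x)) \<le> (\<Sum>i. norm (f (i + n) x))"
        using ae ae'
      proof eventually_elim
        case (elim x)
        have "g x - (\<Sum>i<n. f i x) = (\<Sum>i. f (i + n) x)"
          unfolding g_def using suminf_minus_initial_segment[OF summable_norm_cancel[OF elim(1)], of n]
          by simp
        then show ?case using summable_norm[OF elim(2)] by simp
      qed
    qed fact
    also have "\<dots> = (\<Sum>i. \<integral>x. norm (f (i + n) x) \<partial>M)"
      using int ae' sum' by (intro integral_suminf) auto
    finally show ?thesis by (simp add: L1_norm_def)
  qed
  with g show "\<exists>g\<in>{f. integrable M f}. \<forall>n. L1_norm M (\<lambda>x. g x - (\<Sum>i<n. f i x))
      \<le> (\<Sum>i. L1_norm M (f (i + n)))"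
    by auto
qed (auto simp: L1_norm_def norm_mult)

lemma Linf_AE_le:
  assumes "esssup M (\<lambda>x. ennreal (norm (f x))) < \<infinity>"
  shows "AE x in M. norm (f x) \<le> Linf_norm M f"
  using esssup_AE[of "\<lambda>x. ennreal (norm (f x))" M]
proof eventually_elim
  case (elim x)
  then have "enn2real (ennreal (norm (f x))) \<le> Linf_norm M f"
    unfolding Linf_norm_def using assms by (intro enn2real_mono) auto
  then show ?case by simp
qed

lemma Linf_I:
  assumes [measurable]: "f \<in> borel_measurable M" and ae: "AE x in M. norm (f x) \<le> c" and c: "0 \<le> c"
  shows "esssup M (\<lambda>x. ennreal (norm (f x))) < \<infinity>" "Linf_norm M f \<le> c"
proof -
  have le: "esssup M (\<lambda>x. ennreal (norm (f x))) \<le> ennreal c"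
    using ae by (intro esssup_I) (auto elim!: eventually_mono intro: ennreal_leI)
  then show "esssup M (\<lambda>x. ennreal (norm (f x))) < \<infinity>"
    using ennreal_less_top[of c] by (auto intro: le_less_trans)
  show "Linf_norm M f \<le> c"
    unfolding Linf_norm_def using enn2real_mono[OF le] c by simp
qed

lemma Linf_norm_nonneg: "0 \<le> Linf_norm M f"
  by (simp add: Linf_norm_def)

lemma ae_seminorm_Linf:
  "ae_seminorm M
     {f :: 'a \<Rightarrow> 'k::{real_normed_field, banach, second_countable_topology}.
        f \<in> borel_measurable M \<and> esssup M (\<lambda>x. ennreal (norm (f x))) < \<infinity>} (Linf_norm M)"
  (is "ae_seminorm M ?F _")
proof
  fix f g :: "'a \<Rightarrow> 'k" and c :: 'k
  show "(\<lambda>_. 0) \<in> ?F"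
    using Linf_I(1)[of "\<lambda>_. 0::'k" M 0] by simp
  have zero: "Linf_norm M (\<lambda>_. 0::'k) \<le> 0"
    by (rule Linf_I(2)) auto
  then show "Linf_norm M (\<lambda>_. 0::'k) = 0"
    using Linf_norm_nonneg[of M "\<lambda>_. 0::'k"] by simp
  show "Linf_norm M f = Linf_norm M g"
    if [measurable]: "f \<in> borel_measurable M" "g \<in> borel_measurable M" and "AE x in M. f x = g x"
    unfolding Linf_norm_def using that(3) by (intro arg_cong[where f=enn2real] esssup_AE_cong) auto
  assume f: "f \<in> ?F"
  then have fm [measurable]: "f \<in> borel_measurable M" by simp
  have f_le: "AE x in M. norm (f x) \<le> Linf_norm M f"
    using f by (intro Linf_AE_le) simp
  show "f \<in> borel_measurable M" by fact
  show "0 \<le> Linf_norm M f" by (rule Linf_norm_nonneg)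
  show "AE x in M. f x = 0" if "Linf_norm M f = 0"
    using f_le that by simp
  have scale_le: "AE x in M. norm (d * h x) \<le> norm d * Linf_norm M h" if "h \<in> ?F" for d and h :: "'a \<Rightarrow> 'k"
  proof -
    have "AE x in M. norm (h x) \<le> Linf_norm M h"
      using that by (intro Linf_AE_le) simp
    then show ?thesis
      by eventually_elim (simp add: norm_mult mult_left_mono)
  qed
  show cf: "(\<lambda>x. c * f x) \<in> ?F"
    using Linf_I(1)[OF _ scale_le[OF f]] Linf_norm_nonneg[of M f] by simp
  have upper: "Linf_norm M (\<lambda>x. c * f x) \<le> norm c * Linf_norm M f"
    using Linf_I(2)[OF _ scale_le[OF f]] Linf_norm_nonneg[of M f] by simp
  show "Linf_norm M (\<lambda>x. c * f x) = norm c * Linf_norm M f"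
  proof (cases "c = 0")
    case True
    then show ?thesis using zero Linf_norm_nonneg[of M "\<lambda>_. 0::'k"] by simp
  next
    case False
    have "AE x in M. norm (f x) \<le> inverse (norm c) * Linf_norm M (\<lambda>x. c * f x)"
      using scale_le[OF cf, of "inverse c"] False by (simp add: mult.assoc[symmetric] norm_inverse)
    then have "Linf_norm M f \<le> inverse (norm c) * Linf_norm M (\<lambda>x. c * f x)"
      by (intro Linf_I(2)) (simp_all add: Linf_norm_nonneg)
    then have "norm c * Linf_norm M f \<le> Linf_norm M (\<lambda>x. c * f x)"
      using False by (simp add: field_simps)
    with upper show ?thesis by simp
  qed
  assume g: "g \<in> ?F"
  then have [measurable]: "g \<in> borel_measurable M" by simp
  have "AE x in M. norm (g x) \<le> Linf_norm M g"
    using g by (intro Linf_AE_le) simp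
  with f_le have sum_le: "AE x in M. norm (f x + g x) \<le> Linf_norm M f + Linf_norm M g"
    by eventually_elim (rule norm_triangle_mono)
  show "(\<lambda>x. f x + g x) \<in> ?F"
    using Linf_I(1)[OF _ sum_le] Linf_norm_nonneg[of M f] Linf_norm_nonneg[of M g] by simp
  show "Linf_norm M (\<lambda>x. f x + g x) \<le> Linf_norm M f + Linf_norm M g"
    using Linf_I(2)[OF _ sum_le] Linf_norm_nonneg[of M f] Linf_norm_nonneg[of M g] by simp
next
  fix f :: "nat \<Rightarrow> 'a \<Rightarrow> 'k"
  assume f: "\<And>i. f i \<in> ?F" and sum: "summable (\<lambda>i. Linf_norm M (f i))"
  then have [measurable]: "\<And>i. f i \<in> borel_measurable M" by simp
  have "AE x in M. norm (f i x) \<le> Linf_norm M (f i)" for i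
    using f[of i] by (intro Linf_AE_le) simp
  then have ae: "AE x in M. \<forall>i. norm (f i x) \<le> Linf_norm M (f i)"
    by (simp add: AE_all_countable)
  define g where "g x = (\<Sum>i. f i x)" for x
  have [measurable]: "g \<in> borel_measurable M"
    unfolding g_def[abs_def] by simp
  have sum': "summable (\<lambda>i. Linf_norm M (f (i + n)))" for n
    using summable_ignore_initial_segment[OF sum] by simp
  have le: "AE x in M. norm (g x - (\<Sum>i<n. f i x)) \<le> (\<Sum>i. Linf_norm M (f (i + n)))" for n
    using ae
  proof eventually_elim
    case (elim x)
    have s: "summable (\<lambda>i. norm (f i x))"
      by (rule summable_comparison_test[OF _ sum]) (use elim in auto)
    have s': "summable (\<lambda>i. norm (f (i + n) x))"
      using summable_ignore_initial_segment[OF s] by simp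
    have "norm (g x - (\<Sum>i<n. f i x)) = norm (\<Sum>i. f (i + n) x)"
      unfolding g_def using suminf_minus_initial_segment[OF summable_norm_cancel[OF s], of n] by simp
    also have "\<dots> \<le> (\<Sum>i. norm (f (i + n) x))"
      by (rule summable_norm[OF s'])
    also have "\<dots> \<le> (\<Sum>i. Linf_norm M (f (i + n)))"
      using elim by (intro suminf_le s' sum') auto
    finally show ?case .
  qed
  have nonneg: "0 \<le> (\<Sum>i. Linf_norm M (f (i + n)))" for n
    by (intro suminf_nonneg sum' Linf_norm_nonneg)
  have "g \<in> ?F"
    using Linf_I(1)[OF _ le[of 0] nonneg[of 0]] by simp
  moreover have "Linf_norm M (\<lambda>x. g x - (\<Sum>i<n. f i x)) \<le> (\<Sum>i. Linf_norm M (f (i + n)))" for n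
    by (rule Linf_I(2)[OF _ le nonneg]) simp
  ultimately show "\<exists>g\<in>?F. \<forall>n. Linf_norm M (\<lambda>x. g x - (\<Sum>i<n. f i x))
      \<le> (\<Sum>i. Linf_norm M (f (i + n)))"
    by blast
qed

theorem banach_L1: "banach_nspace (L1 TYPE('k::{real_normed_field, banach, second_countable_topology}) M)"
  unfolding L1_def by (rule ae_seminorm.banach[OF ae_seminorm_L1])

theorem banach_Linf: "banach_nspace (Linf TYPE('k::{real_normed_field, banach, second_countable_topology}) M)"
  unfolding Linf_def by (rule ae_seminorm.banach[OF ae_seminorm_Linf])


section \<open>Localizable measures\<close>

definition semifinite :: "'a measure \<Rightarrow> bool" where
  "semifinite M \<longleftrightarrow> (\<forall>A\<in>sets M. emeasure M A = \<infinity> \<longrightarrow>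
     (\<exists>B\<in>sets M. B \<subseteq> A \<and> 0 < emeasure M B \<and> emeasure M B < \<infinity>))"

text \<open>In the measure algebra, the class of \<open>A\<close> is below the class of \<open>B\<close> iff \<open>A - B\<close> is a null set.\<close>

definition is_esssup_set :: "'a measure \<Rightarrow> 'a set set \<Rightarrow> 'a set \<Rightarrow> bool" where
  "is_esssup_set M \<A> E \<longleftrightarrow> E \<in> sets M \<and> (\<forall>A\<in>\<A>. A - E \<in> null_sets M) \<and>
     (\<forall>G\<in>sets M. (\<forall>A\<in>\<A>. A - G \<in> null_sets M) \<longrightarrow> E - G \<in> null_sets M)"

definition localizable :: "'a measure \<Rightarrow> bool" where
  "localizable M \<longleftrightarrow> semifinite M \<and> (\<forall>\<A>\<subseteq>sets M. \<exists>E. is_esssup_set M \<A> E)"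

end

theory Submission
  imports Defs "HOL-Probability.Probability_Measure"
begin

text \<open>
  Let \<open>T\<close> be of norm one and let \<open>norm (T f\<^sub>0)\<close> be nearly one on a set \<open>B\<close> of finite positive measure. For the
  probability measures \<open>\<bar>f\<^sub>0\<bar>\<mu>\<close> and \<open>\<nu>(\<cdot> | B)\<close>, the operator \<open>u \<mapsto> T (u f\<^sub>0) / sgn (T f\<^sub>0)\<close> has a
  kernel \<open>h\<close> with \<open>norm h \<le> 1\<close> whose integral is nearly one, so \<open>h\<close> is close to one on a set \<open>W\<close> of nearly
  full measure. Replacing \<open>h\<close> by \<open>1\<close> on \<open>W\<close> moves \<open>T\<close> by little. Passing to subrectangles again and
  again, with summable losses on the side of \<open>\<mu>\<close> only, yields a set \<open>A\<close> that is nearly everything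
  and sets \<open>C\<close> of positive measure such that \<open>W\<close> fills an arbitrarily large fraction of \<open>C \<times> A\<close>;
  this replaces a density theorem, and the new operator attains its norm at the normalised
  restriction of \<open>f\<^sub>0\<close> to \<open>A\<close>.
\<close>

subsection \<open>Rectangles nearly filled by a measurable set\<close>

text \<open>Norm attainment in L_infinity concerns an essential supremum: it suffices that no
  smaller bound holds almost everywhere, and no single \<open>t\<close> has to be exact. Hence
  \<open>C\<close> may shrink with the tolerance, while \<open>A\<close> must stay fixed, because it
  determines the point where the norm is attained. This asymmetry is why the loss is charged to one
  factor only. In all products the first factor carries \<nu> and the second \<mu>. The other
  obstacle is that the operator, on functions, is linear only up to null sets depending on its
  arguments, and that \<mu> need not be sigma-finite. After localisation the kernel is found by
  minimising a quadratic functional over kernels with countably many cells, so that only countably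
  many null sets meet at a time. Constants: Chebyshev costs
  \<open>2 * \<eta> / \<delta>\<^sup>2\<close>, the geometric series of losses multiplies this by 6,
  and \<open>\<delta> = e / 2\<close> leaves room for a strict inequality. The new point is at
  distance \<open>2 - 2 * m\<close> from the old one, \<open>m\<close> being the mass of
  \<open>A\<close>, so a lost mass of \<open>e / 4\<close> is affordable.\<close>

context pair_prob_space
begin

text \<open>A countable union of rectangles whose first sides, the cells of \<open>J\<close>, form a
  partition. Partitioning the first factor is what allows the later averaging over cells; an index
  in \<open>nat\<close> makes common refinements available through
  \<open>prod_encode\<close>.\<close>

definition sections :: "('a \<Rightarrow> nat) \<Rightarrow> (nat \<Rightarrow> 'b set) \<Rightarrow> ('a \<times> 'b) set" where
  "sections J V = {z \<in> space (M1 \<Otimes>\<^sub>M M2). snd z \<in> V (J (fst z))}"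

lemma sets_sections [measurable]:
  assumes [measurable]: "J \<in> measurable M1 (count_space UNIV)" and V: "\<And>j. V j \<in> sets M2"
  shows "sections J V \<in> sets (M1 \<Otimes>\<^sub>M M2)"
proof -
  have "sections J V = (\<Union>j. {t \<in> space M1. J t = j} \<times> V j)"
    using V[THEN sets.sets_into_space] by (fastforce simp: sections_def space_pair_measure)
  moreover have "{t \<in> space M1. J t = j} \<times> V j \<in> sets (M1 \<Otimes>\<^sub>M M2)" for j
    by (intro pair_measureI V) measurable
  ultimately show ?thesis by auto
qed

definition approximable :: "('a \<times> 'b) set \<Rightarrow> bool" where
  "approximable W \<longleftrightarrow> (\<forall>e>0. \<exists>J\<in>measurable M1 (count_space UNIV). \<exists>V. (\<forall>j. V j \<in> sets M2) \<and>
     measure (M1 \<Otimes>\<^sub>M M2) (sym_diff W (sections J V)) < e)"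

lemma approximable_Un:
  assumes AB [measurable]: "A \<in> sets (M1 \<Otimes>\<^sub>M M2)" "B \<in> sets (M1 \<Otimes>\<^sub>M M2)"
    and "approximable A" "approximable B"
  shows "approximable (A \<union> B)"
  unfolding approximable_def
proof (intro allI impI)
  fix e :: real assume "0 < e"
  then have e: "0 < e / 2" by simp
  from assms(3) e obtain J1 V1 where [measurable]: "J1 \<in> measurable M1 (count_space UNIV)"
    and V1 [measurable]: "\<And>j. V1 j \<in> sets M2"
    and 1: "measure (M1 \<Otimes>\<^sub>M M2) (sym_diff A (sections J1 V1)) < e / 2"
    unfolding approximable_def by meson
  from assms(4) e obtain J2 V2 where [measurable]: "J2 \<in> measurable M1 (count_space UNIV)"
    and V2 [measurable]: "\<And>j. V2 j \<in> sets M2"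
    and 2: "measure (M1 \<Otimes>\<^sub>M M2) (sym_diff B (sections J2 V2)) < e / 2"
    unfolding approximable_def by meson
  \<comment> \<open>Common refinement of the two partitions: the new index remembers both old
    ones.\<close>
  define J where "J t = prod_encode (J1 t, J2 t)" for t
  define V where "V j = V1 (fst (prod_decode j)) \<union> V2 (snd (prod_decode j))" for j
  have J: "J \<in> measurable M1 (count_space UNIV)"
    unfolding J_def[abs_def] by measurable
  have V: "V j \<in> sets M2" for j
    unfolding V_def by measurable
  have "sym_diff (A \<union> B) (sections J V)
      \<subseteq> sym_diff A (sections J1 V1) \<union> sym_diff B (sections J2 V2)"
    by (auto simp: sections_def J_def V_def)
  then have "measure (M1 \<Otimes>\<^sub>M M2) (sym_diff (A \<union> B) (sections J V))
      \<le> measure (M1 \<Otimes>\<^sub>M M2) (sym_diff A (sections J1 V1) \<union> sym_diff B (sections J2 V2))"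
    by (intro P.finite_measure_mono) measurable
  also have "\<dots> \<le> measure (M1 \<Otimes>\<^sub>M M2) (sym_diff A (sections J1 V1))
      + measure (M1 \<Otimes>\<^sub>M M2) (sym_diff B (sections J2 V2))"
    by (intro measure_Un_le) measurable
  also have "\<dots> < e" using 1 2 by simp
  finally show "\<exists>J\<in>measurable M1 (count_space UNIV). \<exists>V. (\<forall>j. V j \<in> sets M2) \<and>
      measure (M1 \<Otimes>\<^sub>M M2) (sym_diff (A \<union> B) (sections J V)) < e"
    using J V by blast
qed

lemma approximable_Times:
  assumes [measurable]: "C \<in> sets M1" "A \<in> sets M2"
  shows "approximable (C \<times> A)"
proof -
  define J :: "'a \<Rightarrow> nat" where "J t = (if t \<in> C then 1 else 0)" for t
  define V :: "nat \<Rightarrow> 'b set" where "V j = (if j = 1 then A else {})" for j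
  have J: "J \<in> measurable M1 (count_space UNIV)"
    unfolding J_def[abs_def] by measurable
  have V: "\<forall>j. V j \<in> sets M2"
    by (simp add: V_def)
  have "C \<subseteq> space M1" "A \<subseteq> space M2" using assms[THEN sets.sets_into_space] by auto
  then have "sections J V = C \<times> A"
    by (auto simp: sections_def J_def V_def space_pair_measure split: if_splits)
  with J V show ?thesis
    unfolding approximable_def by (metis Diff_cancel Un_empty_left measure_empty)
qed

text \<open>Dynkin's argument, as rectangles form an intersection-stable generator. Complements keep
  the partition \<open>J\<close>, and a countable union is within \<open>e / 2\<close> of one of its
  finite partial unions, which \<open>approximable_Un\<close> handles.\<close>

lemma approximable_measurable:
  assumes "W \<in> sets (M1 \<Otimes>\<^sub>M M2)"
  shows "approximable W"
  using Int_stable_pair_measure_generator[of M1 M2] pair_measure_closed[of M1 M2]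
    assms[unfolded sets_pair_measure]
proof (induction rule: sigma_sets_induct_disjoint)
  case (basic W)
  then show ?case using approximable_Times by blast
next
  case empty
  show ?case using approximable_Times[of "{}" "{}"] by simp
next
  case (compl W)
  note [measurable] = compl(1)[folded sets_pair_measure]
  show ?case
    unfolding approximable_def
  proof (intro allI impI)
    fix e :: real assume "0 < e"
    with compl(2) obtain J V where J: "J \<in> measurable M1 (count_space UNIV)"
      and V: "\<And>j. V j \<in> sets M2"
      and 1: "measure (M1 \<Otimes>\<^sub>M M2) (sym_diff W (sections J V)) < e"
      unfolding approximable_def by meson
    have "W \<subseteq> space M1 \<times> space M2"
      using compl(1)[folded sets_pair_measure, THEN sets.sets_into_space]
      by (simp add: space_pair_measure)
    then have "sym_diff (space M1 \<times> space M2 - W) (sections J (\<lambda>j. space M2 - V j))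
        = sym_diff W (sections J V)"
      by (auto simp: sections_def space_pair_measure)
    moreover have "\<forall>j. space M2 - V j \<in> sets M2" using V by auto
    ultimately show "\<exists>J\<in>measurable M1 (count_space UNIV). \<exists>V. (\<forall>j. V j \<in> sets M2) \<and>
      measure (M1 \<Otimes>\<^sub>M M2) (sym_diff (space M1 \<times> space M2 - W) (sections J V)) < e"
      using J 1 by metis
  qed
next
  case (union W)
  then have [measurable]: "W i \<in> sets (M1 \<Otimes>\<^sub>M M2)" for i
    by (auto simp: sets_pair_measure)
  have fin: "approximable (\<Union>i<n. W i)" for n
  proof (induction n)
    case 0
    then show ?case using approximable_Times[of "{}" "{}"] by simp
  next
    case (Suc n)
    then show ?case
      using approximable_Un[OF _ _ union(3)[of n] Suc] by (simp add: lessThan_Suc)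
  qed
  show ?case
    unfolding approximable_def
  proof (intro allI impI)
    fix e :: real assume "0 < e"
    then have e: "0 < e / 2" by simp
    have inc: "incseq (\<lambda>n. \<Union>i<n. W i)"
      by (rule incseq_SucI) (simp add: lessThan_Suc)
    have "(\<lambda>n. measure (M1 \<Otimes>\<^sub>M M2) (\<Union>i<n. W i)) \<longlonglongrightarrow> measure (M1 \<Otimes>\<^sub>M M2) (\<Union>n. \<Union>i<n. W i)"
      by (rule P.finite_Lim_measure_incseq[OF _ inc], rule image_subsetI) measurable
    also have "(\<Union>n. \<Union>i<n. W i) = (\<Union>i. W i)" by auto
    finally have "\<forall>\<^sub>F n in sequentially.
        measure (M1 \<Otimes>\<^sub>M M2) (\<Union>i. W i) - e / 2 < measure (M1 \<Otimes>\<^sub>M M2) (\<Union>i<n. W i)"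
      by (rule order_tendstoD) (use e in simp)
    then obtain n where
      "measure (M1 \<Otimes>\<^sub>M M2) (\<Union>i. W i) - e / 2 < measure (M1 \<Otimes>\<^sub>M M2) (\<Union>i<n. W i)"
      by (auto simp: eventually_sequentially)
    moreover have "measure (M1 \<Otimes>\<^sub>M M2) ((\<Union>i. W i) - (\<Union>i<n. W i))
        = measure (M1 \<Otimes>\<^sub>M M2) (\<Union>i. W i) - measure (M1 \<Otimes>\<^sub>M M2) (\<Union>i<n. W i)"
      by (intro P.finite_measure_Diff) auto
    ultimately have n: "measure (M1 \<Otimes>\<^sub>M M2) ((\<Union>i. W i) - (\<Union>i<n. W i)) < e / 2" by simp
    from fin[of n] e obtain J V where J [measurable]: "J \<in> measurable M1 (count_space UNIV)"
      and V [measurable]: "\<And>j. V j \<in> sets M2"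
      and 1: "measure (M1 \<Otimes>\<^sub>M M2) (sym_diff (\<Union>i<n. W i) (sections J V)) < e / 2"
      unfolding approximable_def by meson
    have "sym_diff A S \<subseteq> (A - B) \<union> sym_diff B S" if "B \<subseteq> A" for A B S :: "('a \<times> 'b) set"
      using that by blast
    from this[of "\<Union>i<n. W i" "\<Union>i. W i" "sections J V"]
    have "measure (M1 \<Otimes>\<^sub>M M2) (sym_diff (\<Union>i. W i) (sections J V))
      \<le> measure (M1 \<Otimes>\<^sub>M M2) (((\<Union>i. W i) - (\<Union>i<n. W i)) \<union> sym_diff (\<Union>i<n. W i) (sections J V))"
      by (intro P.finite_measure_mono) (blast, measurable)
    also have "\<dots> \<le> measure (M1 \<Otimes>\<^sub>M M2) ((\<Union>i. W i) - (\<Union>i<n. W i))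
        + measure (M1 \<Otimes>\<^sub>M M2) (sym_diff (\<Union>i<n. W i) (sections J V))"
      by (intro measure_Un_le) measurable
    also have "\<dots> < e" using n 1 by simp
    finally show "\<exists>J\<in>measurable M1 (count_space UNIV). \<exists>V. (\<forall>j. V j \<in> sets M2) \<and>
      measure (M1 \<Otimes>\<^sub>M M2) (sym_diff (\<Union>i. W i) (sections J V)) < e"
      using J V by blast
  qed
qed

section \<open>Concentration of a large set on subrectangles\<close>

lemma measure_Times: 
  assumes "C \<in> sets M1" "A \<in> sets M2"
  shows "measure (M1 \<Otimes>\<^sub>M M2) (C \<times> A) = measure M1 C * measure M2 A"
  using assms by (simp add: measure_def M2.emeasure_pair_measure_Times enn2real_mult)

text \<open>Pigeonhole over the cells \<open>C \<inter> {J = j}\<close> of an approximation of \<open>W\<close> by \<^const>\<open>sections\<close>.\<close>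

lemma concentrate_step:
  assumes W [measurable]: "W \<in> sets (M1 \<Otimes>\<^sub>M M2)"
    and C [measurable]: "C \<in> sets M1" "0 < measure M1 C" and A [measurable]: "A \<in> sets M2"
    and le: "measure (M1 \<Otimes>\<^sub>M M2) (C \<times> A - W) \<le> d * measure M1 C"
    and d: "0 < d" "0 < d'"
  obtains C' A' where "C' \<in> sets M1" "0 < measure M1 C'" "A' \<in> sets M2" "A' \<subseteq> A"
    "measure M2 (A - A') \<le> 3 * d" "measure (M1 \<Otimes>\<^sub>M M2) (C' \<times> A' - W) \<le> d' * measure M1 C'"
proof -
  let ?P = "M1 \<Otimes>\<^sub>M M2"
  \<comment> \<open>The weight \<open>K\<close> makes the single inequality
    \<open>a j + K * b j \<le> 3 * d * measure M1 (Cj j)\<close> yield both conclusions: dropping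
    \<open>b\<close> bounds the loss in \<open>A\<close>, dropping \<open>a\<close> bounds the new
    defect by \<open>d'\<close>.\<close>
  define K where "K = 3 * d / d'"
  have K: "0 < K" using d by (simp add: K_def)
  \<comment> \<open>The approximation error enters once through \<open>a\<close> and
    \<open>K\<close> times through \<open>b\<close>; with this \<open>e\<close> the contributions
    add up to \<open>d * measure M1 C\<close>.\<close>
  define e where "e = d * measure M1 C / (1 + K)"
  have e: "0 < e" "(1 + K) * e = d * measure M1 C"
    using d C K by (simp_all add: e_def field_simps)
  have "approximable W" by (rule approximable_measurable) fact
  with e(1) obtain J V where J [measurable]: "J \<in> measurable M1 (count_space UNIV)"
    and V [measurable]: "\<And>j. V j \<in> sets M2"
    and VW: "measure ?P (sym_diff W (sections J V)) < e"
    unfolding approximable_def by meson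
  define Cj where "Cj j = C \<inter> {t \<in> space M1. J t = j}" for j
  have Cj [measurable]: "Cj j \<in> sets M1" for j unfolding Cj_def by measurable
  have V_sub: "V j \<subseteq> space M2" for j using V[THEN sets.sets_into_space] .
  have sub: "C \<subseteq> space M1" "A \<subseteq> space M2" using sets.sets_into_space by measurable
  \<comment> \<open>\<open>a j\<close> is what the cell pays for cutting \<open>A\<close> down to
    \<open>V j\<close>; \<open>b j\<close> is what the remaining rectangle still has outside
    \<open>W\<close>.\<close>
  define a where "a j = measure ?P (Cj j \<times> (A - V j))" for j
  define b where "b j = measure ?P (Cj j \<times> (A \<inter> V j) - W)" for j
  have "a sums measure ?P (\<Union>j. Cj j \<times> (A - V j))"
    unfolding a_def[abs_def] by (intro P.finite_measure_UNION) (auto simp: disjoint_family_on_def Cj_def)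
  also have "(\<Union>j. Cj j \<times> (A - V j)) = C \<times> A - sections J V"
    using sub by (auto simp: Cj_def sections_def space_pair_measure)
  finally have a: "a sums measure ?P (C \<times> A - sections J V)" .
  have "measure ?P (C \<times> A - sections J V) \<le> measure ?P ((C \<times> A - W) \<union> sym_diff W (sections J V))"
    by (intro P.finite_measure_mono) auto
  also have "\<dots> \<le> measure ?P (C \<times> A - W) + measure ?P (sym_diff W (sections J V))"
    by (intro measure_Un_le) measurable
  finally have a_le: "measure ?P (C \<times> A - sections J V) \<le> d * measure M1 C + e"
    using le VW by simp
  have "b sums measure ?P (\<Union>j. Cj j \<times> (A \<inter> V j) - W)"
    unfolding b_def[abs_def] by (intro P.finite_measure_UNION) (auto simp: disjoint_family_on_def Cj_def)
  also have "(\<Union>j. Cj j \<times> (A \<inter> V j) - W) = C \<times> A \<inter> sections J V - W"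
    using sub by (auto simp: Cj_def sections_def space_pair_measure)
  finally have b: "b sums measure ?P (C \<times> A \<inter> sections J V - W)" .
  have "measure ?P (C \<times> A \<inter> sections J V - W) \<le> measure ?P (sym_diff W (sections J V))"
    by (intro P.finite_measure_mono) auto
  then have b_le: "measure ?P (C \<times> A \<inter> sections J V - W) \<le> e" using VW by simp
  have "(\<lambda>j. measure M1 (Cj j)) sums measure M1 (\<Union>j. Cj j)"
    by (intro M1.finite_measure_UNION) (auto simp: disjoint_family_on_def Cj_def)
  also have "(\<Union>j. Cj j) = C" using sub by (auto simp: Cj_def)
  finally have c: "(\<lambda>j. measure M1 (Cj j)) sums measure M1 C" .
  \<comment> \<open>Averaging: summed over all cells, \<open>a + K * b\<close> is at most
    \<open>2 * d * measure M1 C\<close>, so it cannot reach the factor 3 in every cell. Null cells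
    contribute zero to both sides.\<close>
  have "\<exists>j. 0 < measure M1 (Cj j) \<and> a j + K * b j \<le> 3 * d * measure M1 (Cj j)"
  proof (rule ccontr)
    assume neg: "\<nexists>j. 0 < measure M1 (Cj j) \<and> a j + K * b j \<le> 3 * d * measure M1 (Cj j)"
    have "3 * d * measure M1 (Cj j) \<le> a j + K * b j" for j
    proof (cases "0 < measure M1 (Cj j)")
      case True
      with neg show ?thesis by (meson linorder_le_cases)
    next
      case False
      then have "measure M1 (Cj j) = 0" using measure_nonneg[of M1 "Cj j"] by linarith
      then show ?thesis using K by (simp add: a_def b_def)
    qed
    note ge = this
    have "3 * d * measure M1 C
        \<le> measure ?P (C \<times> A - sections J V) + K * measure ?P (C \<times> A \<inter> sections J V - W)"
      by (rule sums_le[OF ge sums_mult[OF c, of "3 * d"] sums_add[OF a sums_mult[OF b, of K]]])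
    also have "\<dots> \<le> d * measure M1 C + e + K * e"
      using a_le b_le K by (intro add_mono mult_left_mono) auto
    also have "\<dots> = 2 * d * measure M1 C" using e(2) by (simp add: algebra_simps)
    finally show False using d(1) C(2) by simp
  qed
  then obtain j where j: "0 < measure M1 (Cj j)" "a j + K * b j \<le> 3 * d * measure M1 (Cj j)" by blast
  have "0 \<le> a j" "0 \<le> b j" by (simp_all add: a_def b_def)
  with j(2) K have aj: "a j \<le> 3 * d * measure M1 (Cj j)" and bj: "K * b j \<le> 3 * d * measure M1 (Cj j)"
    using mult_nonneg_nonneg[of K "b j"] by linarith+
  show ?thesis
  proof
    show "measure M2 (A - A \<inter> V j) \<le> 3 * d"
      using aj j(1) by (simp add: a_def measure_Times Diff_Int mult.commute)
    show "measure ?P (Cj j \<times> (A \<inter> V j) - W) \<le> d' * measure M1 (Cj j)"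
      using bj d unfolding K_def b_def by (simp add: field_simps)
  qed (use j(1) in auto)
qed

text \<open>\<open>concentrate_step\<close> is iterated with the defects \<open>d / 2 ^ n\<close>.
  The losses \<open>3 * d / 2 ^ n\<close> sum to \<open>6 * d\<close>, so the decreasing second
  sides have a large intersection \<open>A\<close>. The first sides are only known to have positive
  measure, hence \<open>C\<close> depends on \<open>e\<close>.\<close>

lemma concentrate:
  assumes W [measurable]: "W \<in> sets (M1 \<Otimes>\<^sub>M M2)"
    and le: "measure (M1 \<Otimes>\<^sub>M M2) (space (M1 \<Otimes>\<^sub>M M2) - W) \<le> d" and d: "0 < d"
  obtains A where "A \<in> sets M2" "1 - 6 * d \<le> measure M2 A"
    "\<And>e. 0 < e \<Longrightarrow> \<exists>C\<in>sets M1. 0 < measure M1 C \<and> measure (M1 \<Otimes>\<^sub>M M2) (C \<times> A - W) \<le> e * measure M1 C"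
proof -
  let ?P = "M1 \<Otimes>\<^sub>M M2"
  \<comment> \<open>\<open>6 * d * (1 - 1 / 2 ^ n)\<close> is the sum of the losses
    \<open>3 * d / 2 ^ k\<close> over \<open>k < n\<close>.\<close>
  define R where "R n CA \<longleftrightarrow> fst CA \<in> sets M1 \<and> 0 < measure M1 (fst CA) \<and> snd CA \<in> sets M2 \<and>
    measure ?P (fst CA \<times> snd CA - W) \<le> d / 2 ^ n * measure M1 (fst CA) \<and>
    1 - 6 * d * (1 - 1 / 2 ^ n) \<le> measure M2 (snd CA)" for n :: nat and CA
  have "\<exists>f. \<forall>n. R n (f n) \<and> snd (f (Suc n)) \<subseteq> snd (f n)"
  proof (rule dependent_nat_choice)
    show "\<exists>CA. R 0 CA"
      using le by (intro exI[of _ "(space M1, space M2)"])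
        (auto simp: R_def M1.prob_space M2.prob_space space_pair_measure)
  next
    fix CA n assume CA: "R n CA"
    obtain C' A' where *: "C' \<in> sets M1" "0 < measure M1 C'" "A' \<in> sets M2" "A' \<subseteq> snd CA"
      "measure M2 (snd CA - A') \<le> 3 * (d / 2 ^ n)"
      "measure ?P (C' \<times> A' - W) \<le> d / 2 ^ Suc n * measure M1 C'"
    proof (rule concentrate_step[OF W, of "fst CA" "snd CA" "d / 2 ^ n" "d / 2 ^ Suc n"])
    qed (use CA d in \<open>auto simp: R_def\<close>)
    have "measure M2 (snd CA - A') = measure M2 (snd CA) - measure M2 A'"
      using CA * by (intro M2.finite_measure_Diff) (auto simp: R_def)
    then have "measure M2 A' \<ge> 1 - 6 * d * (1 - 1 / 2 ^ n) - 3 * (d / 2 ^ n)"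
      using CA *(5) by (auto simp: R_def)
    also have "1 - 6 * d * (1 - 1 / 2 ^ n) - 3 * (d / 2 ^ n) = 1 - 6 * d * (1 - 1 / 2 ^ Suc n)"
      by (simp add: field_simps)
    finally show "\<exists>CA'. R (Suc n) CA' \<and> snd CA' \<subseteq> snd CA"
      using * by (intro exI[of _ "(C', A')"]) (auto simp: R_def)
  qed
  then obtain f where f: "\<And>n. R n (f n)" and dec: "\<And>n. snd (f (Suc n)) \<subseteq> snd (f n)" by blast
  define A where "A = (\<Inter>n. snd (f n))"
  have fm [measurable]: "snd (f n) \<in> sets M2" "fst (f n) \<in> sets M1" for n
    using f[of n] by (auto simp: R_def)
  have [measurable]: "A \<in> sets M2" unfolding A_def by measurable
  have "decseq (\<lambda>n. snd (f n))" using dec by (rule decseq_SucI)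
  then have "(\<lambda>n. measure M2 (snd (f n))) \<longlonglongrightarrow> measure M2 A"
    unfolding A_def by (intro M2.finite_Lim_measure_decseq) auto
  moreover have "1 - 6 * d \<le> measure M2 (snd (f n))" for n
  proof -
    have "6 * d * (1 - 1 / 2 ^ n) \<le> 6 * d * 1" using d by (intro mult_left_mono) auto
    then show ?thesis using f[of n] by (auto simp: R_def)
  qed
  ultimately have *: "1 - 6 * d \<le> measure M2 A" by (intro LIMSEQ_le_const) auto
  have **: "\<exists>C\<in>sets M1. 0 < measure M1 C \<and> measure ?P (C \<times> A - W) \<le> e * measure M1 C"
    if "0 < e" for e
  proof -
    obtain n where n: "d / e < 2 ^ n" using real_arch_pow[of 2 "d / e"] by auto
    have pos: "0 < measure M1 (fst (f n))" using f[of n] by (auto simp: R_def)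
    \<comment> \<open>Shrinking the second side to \<open>A\<close> can only decrease the defect,
      while the first side, against which it is measured, stays the same.\<close>
    have "measure ?P (fst (f n) \<times> A - W) \<le> measure ?P (fst (f n) \<times> snd (f n) - W)"
      by (intro P.finite_measure_mono) (auto simp: A_def)
    also have "\<dots> \<le> d / 2 ^ n * measure M1 (fst (f n))" using f[of n] by (auto simp: R_def)
    also have "\<dots> \<le> e * measure M1 (fst (f n))"
      using n that pos by (intro mult_right_mono) (auto simp: field_simps)
    finally show ?thesis using pos by auto
  qed
  show ?thesis by (rule that[OF _ * **]) auto
qed

end

subsection \<open>Kernels of operators into \<open>L\<^sub>\<infinity>\<close>\<close>

lemma inner_mult_left_same:
  fixes a x y :: "'k::{real_normed_field, real_inner}"
  shows "inner (a * x) (a * y) = (norm a)\<^sup>2 * inner x y"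
  \<comment> \<open>Polarisation: the norm determines the inner product, and the norm is
    multiplicative.\<close>
  by (simp add: dot_norm norm_mult power_mult_distrib right_diff_distrib flip: distrib_left)

text \<open>Complex conjugation, and the identity on the reals, in a form that makes sense for an
  abstract scalar type.\<close>

definition conj_of :: "'k::{real_normed_field, real_inner} \<Rightarrow> 'k" where
  "conj_of a = of_real ((norm a)\<^sup>2) * inverse a"

lemma norm_conj_of [simp]: "norm (conj_of a) = norm a"
  by (cases "a = 0") (simp_all add: conj_of_def norm_mult norm_inverse power2_eq_square)

text \<open>\<open>inner 1\<close> plays the role of the real part. The identity leads from the real
  inner product, in which the minimisation takes place, to the bilinear product, in which the kernel
  is needed.\<close>

lemma inner_one_conj_of: "inner 1 (conj_of a * b) = inner a b"
proof (cases "a = 0")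
  case False
  have "inner a b = inner (a * 1) (a * (inverse a * b))"
    using False by (simp add: mult.assoc[symmetric])
  also have "\<dots> = (norm a)\<^sup>2 * inner 1 (inverse a * b)"
    by (rule inner_mult_left_same)
  also have "\<dots> = inner 1 ((norm a)\<^sup>2 *\<^sub>R (inverse a * b))" by simp
  also have "\<dots> = inner 1 (conj_of a * b)"
    by (simp add: conj_of_def scaleR_conv_of_real mult.assoc)
  finally show ?thesis by simp
qed (simp add: conj_of_def)

lemma inner_one_mult_eq_zero:
  fixes z :: "'k::{real_normed_field, real_inner}"
  assumes "\<And>c. inner 1 (c * z) = 0"
  shows "z = 0"
  using assms[of "inverse z"] by (cases "z = 0") (auto simp: dot_square_norm)

lemma abs_inner_one_le: "\<bar>inner 1 z\<bar> \<le> norm (z :: 'k::{real_normed_field, real_inner})"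
  using Cauchy_Schwarz_ineq2[of 1 z] by simp

text \<open>Integrated over a probability space with a suitable \<open>s\<close>, this bounds an L_1
  norm by an L_2 norm.\<close>

lemma half_le_square:
  fixes a s :: real
  assumes "0 < s"
  shows "a \<le> (s + a\<^sup>2 / s) / 2"
proof -
  have "0 \<le> (a - s)\<^sup>2 / s" using assms by simp
  also have "\<dots> = a\<^sup>2 / s - 2 * a + s"
    using assms by (simp add: power2_eq_square field_simps)
  finally show ?thesis by simp
qed

lemma section_integrable:
  fixes u :: "'a \<Rightarrow> 'k::{real_normed_field, banach, second_countable_topology}" and h :: "'b \<times> 'a \<Rightarrow> 'k"
  assumes h [measurable]: "h \<in> borel_measurable (M1 \<Otimes>\<^sub>M M2)" and le: "\<And>z. norm (h z) \<le> B"
    and u: "integrable M2 u" and t: "t \<in> space M1"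
  shows "integrable M2 (\<lambda>x. u x * h (t, x))"
proof (rule Bochner_Integration.integrable_bound)
  note [measurable] = borel_measurable_integrable[OF u]
  show "integrable M2 (\<lambda>x. B * norm (u x))" using u by simp
  show "(\<lambda>x. u x * h (t, x)) \<in> borel_measurable M2"
    using t by measurable
  have "norm (u x) * norm (h (t, x)) \<le> norm (u x) * \<bar>B\<bar>" for x
    by (intro mult_left_mono order_trans[OF le]) auto
  then show "AE x in M2. norm (u x * h (t, x)) \<le> norm (B * norm (u x))"
    by (simp add: norm_mult abs_mult mult.commute)
qed

lemma AE_eq_if_set_integrals_eq:
  fixes f g :: "'a \<Rightarrow> 'k::euclidean_space"
  assumes f: "integrable M f" and g: "integrable M g"
    and eq: "\<And>C. C \<in> sets M \<Longrightarrow> (\<integral>x. indicator C x *\<^sub>R f x \<partial>M) = (\<integral>x. indicator C x *\<^sub>R g x \<partial>M)"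
  shows "AE x in M. f x = g x"
proof -
  have "AE x in M. inner b (f x) = inner b (g x)" for b
  proof (rule density_unique_real)
    fix C assume C: "C \<in> sets M"
    have "(\<integral>x\<in>C. inner b (k x) \<partial>M) = inner b (\<integral>x. indicator C x *\<^sub>R k x \<partial>M)" if k: "integrable M k" for k
    proof -
      have "(\<integral>x\<in>C. inner b (k x) \<partial>M) = (\<integral>x. inner b (indicator C x *\<^sub>R k x) \<partial>M)"
        by (simp add: set_lebesgue_integral_def)
      also have "\<dots> = inner b (\<integral>x. indicator C x *\<^sub>R k x \<partial>M)"
        by (rule integral_inner_right) (simp add: integrable_mult_indicator C k)
      finally show ?thesis .
    qed
    then show "(\<integral>x\<in>C. inner b (f x) \<partial>M) = (\<integral>x\<in>C. inner b (g x) \<partial>M)"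
      using f g eq[OF C] by simp
  qed (use f g in auto)
  then have "AE x in M. \<forall>b\<in>Basis. inner b (f x) = inner b (g x)"
    by (simp add: AE_finite_all)
  then show ?thesis
    by eventually_elim (auto intro: euclidean_eqI simp: inner_commute)
qed

text \<open>Operators act on functions, not on classes, so the laws hold only off null sets that
  depend on the arguments. Additivity and \<open>T_bound\<close> together make \<open>T\<close>
  respect equality almost everywhere.\<close>

locale L1_contraction =
  fixes M1 :: "'b measure" and M2 :: "'a measure"
    and T :: "('a \<Rightarrow> 'k::{real_normed_field, euclidean_space}) \<Rightarrow> 'b \<Rightarrow> 'k"
  assumes T_measurable: "integrable M2 u \<Longrightarrow> T u \<in> borel_measurable M1"
    and T_add: "integrable M2 u \<Longrightarrow> integrable M2 v \<Longrightarrow> AE t in M1. T (\<lambda>x. u x + v x) t = T u t + T v t"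
    and T_scale: "integrable M2 u \<Longrightarrow> AE t in M1. T (\<lambda>x. c * u x) t = c * T u t"
    and T_bound: "integrable M2 u \<Longrightarrow> AE t in M1. norm (T u t) \<le> (\<integral>x. norm (u x) \<partial>M2)"

locale dominated_op = pair_prob_space M1 M2 + L1_contraction M1 M2 T
  for M1 :: "'b measure" and M2 :: "'a measure"
    and T :: "('a \<Rightarrow> 'k::{real_normed_field, euclidean_space}) \<Rightarrow> 'b \<Rightarrow> 'k"
begin

text \<open>A pair \<open>(u, J)\<close> stands for the kernel \<open>(t, x) \<mapsto> u (J t) x\<close>, which is constant in \<open>t\<close> on
  each of the countably many cells \<open>{J = j}\<close>.\<close>

definition kernels :: "((nat \<Rightarrow> 'a \<Rightarrow> 'k) \<times> ('b \<Rightarrow> nat)) set" where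
  "kernels = {(u, J). J \<in> measurable M1 (count_space UNIV) \<and> (\<forall>j. u j \<in> borel_measurable M2) \<and>
     (\<exists>b. \<forall>j x. norm (u j x) \<le> b)}"

definition ker :: "(nat \<Rightarrow> 'a \<Rightarrow> 'k) \<times> ('b \<Rightarrow> nat) \<Rightarrow> 'b \<times> 'a \<Rightarrow> 'k" where
  "ker p z = fst p (snd p (fst z)) (snd z)"

text \<open>The functional that integration against the kernel of \<open>T\<close> is to represent.
  Evaluating \<open>T\<close> at a function that varies with \<open>t\<close> makes sense because
  only countably many functions occur.\<close>

definition app :: "(nat \<Rightarrow> 'a \<Rightarrow> 'k) \<times> ('b \<Rightarrow> nat) \<Rightarrow> 'k" where
  "app p = (\<integral>t. T (fst p (snd p t)) t \<partial>M1)"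

lemma kernelsD:
  assumes "p \<in> kernels"
  shows "snd p \<in> measurable M1 (count_space UNIV)" "fst p j \<in> borel_measurable M2"
    "\<exists>b. \<forall>j x. norm (fst p j x) \<le> b"
  using assms by (simp_all add: kernels_def case_prod_beta)

lemma integrable_fst_kernel:
  assumes "p \<in> kernels"
  shows "integrable M2 (fst p j)"
  using kernelsD[OF assms] by (auto intro!: M2.integrable_const_bound)

lemma ker_measurable:
  assumes "p \<in> kernels"
  shows "ker p \<in> borel_measurable (M1 \<Otimes>\<^sub>M M2)"
proof -
  note [measurable] = kernelsD(1,2)[OF assms]
  have "(\<lambda>z. (\<lambda>i z. fst p i (snd z)) (snd p (fst z)) z) \<in> borel_measurable (M1 \<Otimes>\<^sub>M M2)"
    by (rule measurable_compose_countable) measurable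
  then show ?thesis by (simp add: ker_def[abs_def])
qed

lemma ker_bounded:
  assumes "p \<in> kernels"
  shows "\<exists>b. \<forall>z. norm (ker p z) \<le> b"
  using kernelsD(3)[OF assms] by (auto simp: ker_def)

lemma ker_integrable [simp, intro]:
  assumes "p \<in> kernels"
  shows "integrable (M1 \<Otimes>\<^sub>M M2) (ker p)"
proof -
  obtain b where "\<And>z. norm (ker p z) \<le> b" using ker_bounded[OF assms] by auto
  then show ?thesis using ker_measurable[OF assms] by (intro P.integrable_const_bound[of _ b]) auto
qed

lemma ker_norm2_integrable [simp, intro]:
  assumes "p \<in> kernels"
  shows "integrable (M1 \<Otimes>\<^sub>M M2) (\<lambda>z. (norm (ker p z))\<^sup>2)"
proof -
  note [measurable] = ker_measurable[OF assms]
  obtain b where "\<And>z. norm (ker p z) \<le> b" using ker_bounded[OF assms] by auto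
  then have "AE z in M1 \<Otimes>\<^sub>M M2. norm ((norm (ker p z))\<^sup>2) \<le> b\<^sup>2"
    by (auto intro!: power_mono)
  then show ?thesis by (rule P.integrable_const_bound) measurable
qed

lemma app_bound:
  assumes p: "p \<in> kernels"
  shows "integrable M1 (\<lambda>t. T (fst p (snd p t)) t)"
    "norm (app p) \<le> (\<integral>z. norm (ker p z) \<partial>(M1 \<Otimes>\<^sub>M M2))"
proof -
  note [measurable] = kernelsD(1,2)[OF p]
  have m: "(\<lambda>t. T (fst p (snd p t)) t) \<in> borel_measurable M1"
    using T_measurable[OF integrable_fst_kernel[OF p]] kernelsD(1)[OF p]
    by (rule measurable_compose_countable)
  \<comment> \<open>Countability of the index pays off: one null set serves all
    \<open>fst p j\<close>, so the bound survives the substitution of \<open>snd p t\<close> for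
    \<open>j\<close>.\<close>
  have "AE t in M1. \<forall>j. norm (T (fst p j) t) \<le> (\<integral>x. norm (fst p j x) \<partial>M2)"
    unfolding AE_all_countable using T_bound[OF integrable_fst_kernel[OF p]] by simp
  then have ae: "AE t in M1. norm (T (fst p (snd p t)) t) \<le> (\<integral>x. norm (ker p (t, x)) \<partial>M2)"
    by eventually_elim (simp add: ker_def)
  have int: "integrable M1 (\<lambda>t. \<integral>x. norm (ker p (t, x)) \<partial>M2)"
    using integrable_fst'[of "\<lambda>z. norm (ker p z)"] p by auto
  show 1: "integrable M1 (\<lambda>t. T (fst p (snd p t)) t)"
    by (rule Bochner_Integration.integrable_bound[OF int m]) (use ae in eventually_elim, auto)
  have "norm (app p) \<le> (\<integral>t. norm (T (fst p (snd p t)) t) \<partial>M1)"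
    unfolding app_def by (rule integral_norm_bound)
  also have "\<dots> \<le> (\<integral>t. (\<integral>x. norm (ker p (t, x)) \<partial>M2) \<partial>M1)"
    using 1 int ae by (intro integral_mono_AE) auto
  also have "\<dots> = (\<integral>z. norm (ker p z) \<partial>(M1 \<Otimes>\<^sub>M M2))"
    using integral_fst'[of "\<lambda>z. norm (ker p z)"] p by auto
  finally show "norm (app p) \<le> (\<integral>z. norm (ker p z) \<partial>(M1 \<Otimes>\<^sub>M M2))" .
qed

text \<open>Combining two pairs needs a common refinement of their cells, hence
  \<open>prod_encode\<close>. The coefficients are scalars of the field because
  \<open>kernel_exists\<close> multiplies test kernels by arbitrary ones.\<close>

definition lin :: "'k \<Rightarrow> (nat \<Rightarrow> 'a \<Rightarrow> 'k) \<times> ('b \<Rightarrow> nat) \<Rightarrow> 'k \<Rightarrow> (nat \<Rightarrow> 'a \<Rightarrow> 'k) \<times> ('b \<Rightarrow> nat)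
    \<Rightarrow> (nat \<Rightarrow> 'a \<Rightarrow> 'k) \<times> ('b \<Rightarrow> nat)" where
  "lin c p d q = (\<lambda>j x. c * fst p (fst (prod_decode j)) x + d * fst q (snd (prod_decode j)) x,
     \<lambda>t. prod_encode (snd p t, snd q t))"

lemma ker_lin: "ker (lin c p d q) z = c * ker p z + d * ker q z"
  by (simp add: ker_def lin_def)

lemma lin_kernels:
  assumes "p \<in> kernels" "q \<in> kernels"
  shows "lin c p d q \<in> kernels"
proof -
  note [measurable] = kernelsD(1,2)[OF assms(1)] kernelsD(1,2)[OF assms(2)]
  obtain a where a: "\<And>j x. norm (fst p j x) \<le> a" using kernelsD(3)[OF assms(1)] by auto
  obtain b where b: "\<And>j x. norm (fst q j x) \<le> b" using kernelsD(3)[OF assms(2)] by auto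
  have "norm (c * fst p i x + d * fst q j x) \<le> norm c * a + norm d * b" for i j x
    by (rule norm_triangle_mono) (simp_all add: norm_mult mult_left_mono a b)
  then show ?thesis
    unfolding lin_def kernels_def by auto
qed

lemma app_lin:
  assumes p: "p \<in> kernels" and q: "q \<in> kernels"
  shows "app (lin c p d q) = c * app p + d * app q"
proof -
  have "AE t in M1. T (\<lambda>x. c * fst p i x + d * fst q j x) t = c * T (fst p i) t + d * T (fst q j) t" for i j
    using T_add[of "\<lambda>x. c * fst p i x" "\<lambda>x. d * fst q j x"]
      T_scale[OF integrable_fst_kernel[OF p], of c i] T_scale[OF integrable_fst_kernel[OF q], of d j]
      integrable_fst_kernel[OF p, of i] integrable_fst_kernel[OF q, of j]
    by auto
  then have "AE t in M1. \<forall>i j. T (\<lambda>x. c * fst p i x + d * fst q j x) t = c * T (fst p i) t + d * T (fst q j) t"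
    by (simp add: AE_all_countable)
  then have "AE t in M1. T (fst (lin c p d q) (snd (lin c p d q) t)) t
      = c * T (fst p (snd p t)) t + d * T (fst q (snd q t)) t"
    by eventually_elim (simp add: lin_def)
  then have "app (lin c p d q) = (\<integral>t. c * T (fst p (snd p t)) t + d * T (fst q (snd q t)) t \<partial>M1)"
    unfolding app_def
    using app_bound(1)[OF p] app_bound(1)[OF q] app_bound(1)[OF lin_kernels[OF p q, of c d]]
    by (intro integral_cong_AE) auto
  also have "\<dots> = c * app p + d * app q"
    using app_bound(1)[OF p] app_bound(1)[OF q] by (simp add: app_def)
  finally show ?thesis .
qed

section \<open>Riesz representation through an energy\<close>

text \<open>If \<open>h\<close> represents the real part of \<open>app\<close> in the real inner
  product, this is the squared L_2 distance from \<open>ker p\<close> to \<open>h\<close> up to an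
  additive constant, so minimising it finds the representer.\<close>

definition energy :: "(nat \<Rightarrow> 'a \<Rightarrow> 'k) \<times> ('b \<Rightarrow> nat) \<Rightarrow> real" where
  "energy p = (\<integral>z. (norm (ker p z))\<^sup>2 \<partial>(M1 \<Otimes>\<^sub>M M2)) - 2 * inner 1 (app p)"

text \<open>\<open>app\<close> is dominated by the L_1 norm, and
  \<open>r\<^sup>2 - 2 * r \<ge> -1\<close> is integrated over a probability space.\<close>

lemma energy_ge:
  assumes p: "p \<in> kernels"
  shows "-1 \<le> energy p"
proof -
  have "0 \<le> (\<integral>z. (norm (ker p z) - 1)\<^sup>2 \<partial>(M1 \<Otimes>\<^sub>M M2))" by simp
  also have "\<dots> = (\<integral>z. (norm (ker p z))\<^sup>2 \<partial>(M1 \<Otimes>\<^sub>M M2)) - 2 * (\<integral>z. norm (ker p z) \<partial>(M1 \<Otimes>\<^sub>M M2)) + 1"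
    using p by (simp add: power2_diff P.prob_space)
  finally show ?thesis
    using app_bound(2)[OF p] abs_inner_one_le[of "app p"] by (simp add: energy_def)
qed

lemma inner_ker_integrable:
  assumes p: "p \<in> kernels" and h: "integrable (M1 \<Otimes>\<^sub>M M2) h"
  shows "integrable (M1 \<Otimes>\<^sub>M M2) (\<lambda>z. inner (h z) (ker p z))"
proof -
  note [measurable] = ker_measurable[OF p] borel_measurable_integrable[OF h]
  obtain b where b: "\<And>z. norm (ker p z) \<le> b" using ker_bounded[OF p] by auto
  show ?thesis
  proof (rule Bochner_Integration.integrable_bound)
    show "integrable (M1 \<Otimes>\<^sub>M M2) (\<lambda>z. b * norm (h z))" using h by simp
    have "norm (inner (h z) (ker p z)) \<le> norm (b * norm (h z))" for z
    proof -
      have "norm (inner (h z) (ker p z)) \<le> norm (h z) * norm (ker p z)"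
        using Cauchy_Schwarz_ineq2[of "h z" "ker p z"] by simp
      also have "\<dots> \<le> norm (h z) * b" by (intro mult_left_mono b) simp
      also have "\<dots> \<le> norm (b * norm (h z))" by (simp add: mult.commute)
      finally show ?thesis .
    qed
    then show "AE z in M1 \<Otimes>\<^sub>M M2. norm (inner (h z) (ker p z)) \<le> norm (b * norm (h z))" by simp
  qed measurable
qed

text \<open>The parallelogram law; the linear term cancels at the midpoint. Two near-minimisers are
  therefore close in L_2.\<close>

lemma energy_midpoint:
  assumes p: "p \<in> kernels" and q: "q \<in> kernels"
  shows "energy p + energy q - 2 * energy (lin (of_real (1/2)) p (of_real (1/2)) q)
    = (\<integral>z. (norm (ker p z - ker q z))\<^sup>2 \<partial>(M1 \<Otimes>\<^sub>M M2)) / 2"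
    and "integrable (M1 \<Otimes>\<^sub>M M2) (\<lambda>z. (norm (ker p z - ker q z))\<^sup>2)"
proof -
  let ?m = "lin (of_real (1/2)) p (of_real (1/2)) q"
  have eq: "(norm (ker p z - ker q z))\<^sup>2
      = 2 * (norm (ker p z))\<^sup>2 + 2 * (norm (ker q z))\<^sup>2 - 4 * (norm (ker ?m z))\<^sup>2" for z
  proof -
    have "ker ?m z = (1/2) *\<^sub>R (ker p z + ker q z)"
      unfolding ker_lin by (simp only: scaleR_conv_of_real distrib_left)
    then have "4 * (norm (ker ?m z))\<^sup>2 = (norm (ker p z + ker q z))\<^sup>2"
      by (simp add: power_mult_distrib power_divide)
    then show ?thesis
      by (simp add: power2_norm_eq_inner inner_add inner_diff inner_commute)
  qed
  have m: "?m \<in> kernels" by (rule lin_kernels[OF p q])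
  show "integrable (M1 \<Otimes>\<^sub>M M2) (\<lambda>z. (norm (ker p z - ker q z))\<^sup>2)"
    unfolding eq using p q m by (intro Bochner_Integration.integrable_add Bochner_Integration.integrable_diff integrable_mult_right) auto
  have "(\<integral>z. (norm (ker p z - ker q z))\<^sup>2 \<partial>(M1 \<Otimes>\<^sub>M M2)) = 2 * (\<integral>z. (norm (ker p z))\<^sup>2 \<partial>(M1 \<Otimes>\<^sub>M M2))
      + 2 * (\<integral>z. (norm (ker q z))\<^sup>2 \<partial>(M1 \<Otimes>\<^sub>M M2)) - 4 * (\<integral>z. (norm (ker ?m z))\<^sup>2 \<partial>(M1 \<Otimes>\<^sub>M M2))"
    unfolding eq using p q m by simp
  moreover have "inner 1 (app ?m) = (inner 1 (app p) + inner 1 (app q)) / 2"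
    unfolding app_lin[OF p q] by (simp only: scaleR_conv_of_real[symmetric] inner_add_right) simp
  ultimately show "energy p + energy q - 2 * energy ?m
      = (\<integral>z. (norm (ker p z - ker q z))\<^sup>2 \<partial>(M1 \<Otimes>\<^sub>M M2)) / 2"
    by (simp add: energy_def)
qed

text \<open>A quadratic polynomial in \<open>s\<close> whose linear coefficient is twice the error
  made when \<open>ker p\<close> is taken as the representer and tested on \<open>q\<close>.\<close>

lemma energy_variation:
  assumes p: "p \<in> kernels" and q: "q \<in> kernels"
  shows "energy (lin 1 p (of_real s) q) = energy p
    + 2 * s * ((\<integral>z. inner (ker p z) (ker q z) \<partial>(M1 \<Otimes>\<^sub>M M2)) - inner 1 (app q))
    + s\<^sup>2 * (\<integral>z. (norm (ker q z))\<^sup>2 \<partial>(M1 \<Otimes>\<^sub>M M2))"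
proof -
  have eq: "(norm (ker (lin 1 p (of_real s) q) z))\<^sup>2
      = (norm (ker p z))\<^sup>2 + 2 * s * inner (ker p z) (ker q z) + s\<^sup>2 * (norm (ker q z))\<^sup>2" for z
  proof -
    have "ker (lin 1 p (of_real s) q) z = ker p z + s *\<^sub>R ker q z"
      by (simp add: ker_lin scaleR_conv_of_real)
    then show ?thesis
      using dot_norm[of "ker p z" "s *\<^sub>R ker q z"] by (simp add: power_mult_distrib)
  qed
  have "app (lin 1 p (of_real s) q) = app p + s *\<^sub>R app q"
    by (simp add: app_lin[OF p q] scaleR_conv_of_real)
  then have 1: "inner 1 (app (lin 1 p (of_real s) q)) = inner 1 (app p) + s * inner 1 (app q)"
    by (simp add: inner_add_right)
  have "(\<integral>z. (norm (ker (lin 1 p (of_real s) q) z))\<^sup>2 \<partial>(M1 \<Otimes>\<^sub>M M2))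
      = (\<integral>z. (norm (ker p z))\<^sup>2 \<partial>(M1 \<Otimes>\<^sub>M M2)) + 2 * s * (\<integral>z. inner (ker p z) (ker q z) \<partial>(M1 \<Otimes>\<^sub>M M2))
        + s\<^sup>2 * (\<integral>z. (norm (ker q z))\<^sup>2 \<partial>(M1 \<Otimes>\<^sub>M M2))"
    unfolding eq using inner_ker_integrable[OF q ker_integrable[OF p]] p q by simp
  with 1 show ?thesis by (simp add: energy_def algebra_simps)
qed

lemma kernels_zero: "(\<lambda>j x. 0, \<lambda>t. 0) \<in> kernels"
  by (auto simp: kernels_def intro: exI[of _ 0])

text \<open>Riesz representation by hand: a minimising sequence of the energy is Cauchy.\<close>

lemma minimizing_sequence:
  obtains q h I where "\<And>n. q n \<in> kernels" "integrable (M1 \<Otimes>\<^sub>M M2) h"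
    "\<And>p. p \<in> kernels \<Longrightarrow> I \<le> energy p" "\<And>n. energy (q n) \<le> I + (1/4) ^ n"
    "(\<lambda>n. \<integral>z. norm (ker (q n) z - h z) \<partial>(M1 \<Otimes>\<^sub>M M2)) \<longlonglongrightarrow> 0"
    "AE z in M1 \<Otimes>\<^sub>M M2. (\<lambda>n. ker (q n) z) \<longlonglongrightarrow> h z"
proof -
  let ?P = "M1 \<Otimes>\<^sub>M M2"
  define I where "I = Inf (energy ` kernels)"
  have I: "I \<le> energy p" if "p \<in> kernels" for p
    unfolding I_def using that by (intro cInf_lower bdd_belowI2[of _ "-1"]) (auto intro: energy_ge)
  have "\<exists>p. p \<in> kernels \<and> energy p < I + (1/4) ^ n" for n :: nat
    using cInf_lessD[of "energy ` kernels" "I + (1/4) ^ n"] kernels_zero by (force simp: I_def)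
  then obtain p where p: "\<And>n. p n \<in> kernels" and pI: "\<And>n. energy (p n) < I + (1/4) ^ n" by metis
  have close: "(\<integral>z. norm (ker (p m) z - ker (p n) z) \<partial>?P) \<le> (5/2) * (1/2) ^ N" if "m \<ge> N" "n \<ge> N" for m n N
  proof -
    let ?s = "(1/2::real) ^ N"
    let ?D = "\<lambda>z. norm (ker (p m) z - ker (p n) z)"
    have le4: "(1/4::real) ^ k \<le> (1/4) ^ N" if "k \<ge> N" for k
      using that by (intro power_decreasing) auto
    have "(\<integral>z. (?D z)\<^sup>2 \<partial>?P) = 2 * (energy (p m) + energy (p n)
        - 2 * energy (lin (of_real (1/2)) (p m) (of_real (1/2)) (p n)))"
      using energy_midpoint(1)[OF p p, of m n] by simp
    also have "\<dots> \<le> 4 * (1/4) ^ N"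
      using pI[of m] pI[of n] I[OF lin_kernels[OF p p]] le4[OF that(1)] le4[OF that(2)] by smt
    finally have sq: "(\<integral>z. (?D z)\<^sup>2 \<partial>?P) \<le> 4 * (1/4) ^ N" .
    \<comment> \<open>With the parameter \<open>(1/2) ^ N\<close> the squared distance
      \<open>4 * (1/4) ^ N\<close> becomes an L_1 distance of half of \<open>?s + 4 * ?s\<close>,
      whence \<open>5/2\<close>. Convergence in L_1 is enough, as test kernels are bounded.\<close>
    have "?D z \<le> (?s + (?D z)\<^sup>2 / ?s) / 2" for z by (rule half_le_square) simp
    then have "(\<integral>z. ?D z \<partial>?P) \<le> (\<integral>z. (?s + (?D z)\<^sup>2 / ?s) / 2 \<partial>?P)"
      using energy_midpoint(2)[OF p p, of m n] p by (intro integral_mono) auto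
    also have "\<dots> = (?s + (\<integral>z. (?D z)\<^sup>2 \<partial>?P) / ?s) / 2"
      using energy_midpoint(2)[OF p p, of m n] by (simp add: P.prob_space)
    also have "\<dots> \<le> (?s + 4 * (1/4) ^ N / ?s) / 2"
      using sq by (intro divide_right_mono add_left_mono) auto
    also have "4 * (1/4::real) ^ N / ?s = 4 * ?s" by (simp add: power_divide field_simps flip: power_mult_distrib)
    finally show ?thesis by simp
  qed
  interpret L: ae_seminorm ?P "{f :: 'b \<times> 'a \<Rightarrow> 'k. integrable ?P f}" "L1_norm ?P"
    by (rule ae_seminorm_L1)
  have "\<exists>h\<in>{f. integrable ?P f}. (\<lambda>n. L1_norm ?P (\<lambda>z. ker (p n) z - h z)) \<longlonglongrightarrow> 0"
  proof (rule L.complete_F)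
    fix e :: real assume "0 < e"
    then obtain N where N: "(1/2::real) ^ N < e / (5/2)"
      using real_arch_pow_inv[of "e / (5/2)" "1/2"] by auto
    have "L1_norm ?P (\<lambda>z. ker (p m) z - ker (p n) z) < e" if "N \<le> m" "N \<le> n" for m n
      using close[OF that] N by (simp add: L1_norm_def)
    then show "\<exists>N. \<forall>m\<ge>N. \<forall>n\<ge>N. L1_norm ?P (\<lambda>z. ker (p m) z - ker (p n) z) < e" by blast
  qed (use p in auto)
  then obtain h where h: "integrable ?P h"
    and lim: "(\<lambda>n. \<integral>z. norm (ker (p n) z - h z) \<partial>?P) \<longlonglongrightarrow> 0"
    by (auto simp: L1_norm_def)
  \<comment> \<open>Pointwise convergence is needed to apply a nonlinear function to the kernels
    when \<open>norm h \<le> 1\<close> is proved. The energy bound survives because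
    \<open>n \<le> r n\<close>.\<close>
  obtain r :: "nat \<Rightarrow> nat" where r: "strict_mono r"
    and ae: "AE z in ?P. (\<lambda>n. ker (p (r n)) z - h z) \<longlonglongrightarrow> 0"
    using tendsto_L1_AE_subseq[OF _ lim] p h by auto
  show ?thesis
  proof
    show "energy (p (r n)) \<le> I + (1/4) ^ n" for n
    proof -
      have "(1/4::real) ^ r n \<le> (1/4) ^ n" by (intro power_decreasing seq_suble r) auto
      with pI[of "r n"] show ?thesis by linarith
    qed
    show "(\<lambda>n. \<integral>z. norm (ker (p (r n)) z - h z) \<partial>?P) \<longlonglongrightarrow> 0"
      using LIMSEQ_subseq_LIMSEQ[OF lim r] by (simp add: o_def)
    show "AE z in ?P. (\<lambda>n. ker (p (r n)) z) \<longlonglongrightarrow> h z"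
      using ae by eventually_elim (rule LIM_zero_cancel)
  qed (use p I h in auto)
qed

text \<open>The first-order condition at a minimum. As \<open>q n\<close> is only nearly minimal,
  the derivative \<open>\<Delta> n\<close> is only nearly zero; the limit in \<open>n\<close>
  removes the error, and L_1 convergence passes through the pairing because \<open>ker p\<close> is
  bounded.\<close>

lemma minimizer_represents:
  assumes q: "\<And>n. q n \<in> kernels" and h: "integrable (M1 \<Otimes>\<^sub>M M2) h"
    and I: "\<And>p. p \<in> kernels \<Longrightarrow> I \<le> energy p" "\<And>n. energy (q n) \<le> I + (1/4) ^ n"
    and lim: "(\<lambda>n. \<integral>z. norm (ker (q n) z - h z) \<partial>(M1 \<Otimes>\<^sub>M M2)) \<longlonglongrightarrow> 0"
    and p: "p \<in> kernels"
  shows "(\<integral>z. inner (h z) (ker p z) \<partial>(M1 \<Otimes>\<^sub>M M2)) = inner 1 (app p)"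
proof -
  let ?P = "M1 \<Otimes>\<^sub>M M2"
  define \<Delta> where "\<Delta> n = (\<integral>z. inner (ker (q n) z) (ker p z) \<partial>?P) - inner 1 (app p)" for n
  define V where "V = (\<integral>z. (norm (ker p z))\<^sup>2 \<partial>?P)"
  have "\<bar>\<Delta> n\<bar> \<le> (1/2) ^ n * ((1 + V) / 2)" for n
  proof -
    let ?s = "(1/2::real) ^ n"
    have sp: "0 < ?s" by simp
    have quad: "- (?s * ?s) \<le> 2 * s * \<Delta> n + s\<^sup>2 * V" for s
    proof -
      have "I \<le> energy (lin 1 (q n) (of_real s) p)" by (intro I lin_kernels q p)
      also have "\<dots> = energy (q n) + 2 * s * \<Delta> n + s\<^sup>2 * V"
        unfolding energy_variation[OF q p] \<Delta>_def V_def by simp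
      finally show ?thesis using I(2)[of n] by (simp add: power_mult_distrib[symmetric])
    qed
    \<comment> \<open>The step \<open>s = (1/2) ^ n\<close> balances the slack
      \<open>(1/4) ^ n\<close> of \<open>q n\<close> against the quadratic term; the negative step
      gives the opposite sign.\<close>
    have "- (?s * ?s) \<le> ?s * (2 * \<Delta> n) + ?s * (?s * V)"
      using quad[of ?s] by (simp add: power2_eq_square)
    then have "0 \<le> ?s * (2 * \<Delta> n + ?s * V + ?s)" by (simp add: algebra_simps)
    then have 1: "0 \<le> 2 * \<Delta> n + ?s * V + ?s" unfolding zero_le_mult_iff using sp by linarith
    have "- (?s * ?s) \<le> - ?s * (2 * \<Delta> n) + ?s * (?s * V)"
      using quad[of "- ?s"] by (simp add: power2_eq_square)
    then have "0 \<le> ?s * (- 2 * \<Delta> n + ?s * V + ?s)" by (simp add: algebra_simps)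
    then have 2: "0 \<le> - 2 * \<Delta> n + ?s * V + ?s" unfolding zero_le_mult_iff using sp by linarith
    from 1 2 show ?thesis by (simp add: algebra_simps abs_le_iff)
  qed
  moreover have "(\<lambda>n. (1/2) ^ n * ((1 + V) / 2)) \<longlonglongrightarrow> 0"
    by (rule tendsto_mult_left_zero, rule LIMSEQ_power_zero) simp
  ultimately have "\<Delta> \<longlonglongrightarrow> 0"
    by (intro Lim_null_comparison[of \<Delta> "\<lambda>n. (1/2) ^ n * ((1 + V) / 2)"] always_eventually) simp_all
  from tendsto_add[OF this tendsto_const[of "inner 1 (app p)"]]
  have 1: "(\<lambda>n. \<integral>z. inner (ker (q n) z) (ker p z) \<partial>?P) \<longlonglongrightarrow> inner 1 (app p)"
    by (simp add: \<Delta>_def)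
  obtain b where b: "\<And>z. norm (ker p z) \<le> b" using ker_bounded[OF p] by auto
  have "norm ((\<integral>z. inner (ker (q n) z) (ker p z) \<partial>?P) - (\<integral>z. inner (h z) (ker p z) \<partial>?P))
      \<le> (\<integral>z. norm (ker (q n) z - h z) \<partial>?P) * b" for n
  proof -
    have i: "integrable ?P (\<lambda>z. inner (ker (q n) z) (ker p z))" "integrable ?P (\<lambda>z. inner (h z) (ker p z))"
      by (rule inner_ker_integrable[OF p ker_integrable[OF q]], rule inner_ker_integrable[OF p h])
    have "norm ((\<integral>z. inner (ker (q n) z) (ker p z) \<partial>?P) - (\<integral>z. inner (h z) (ker p z) \<partial>?P))
        = norm (\<integral>z. inner (ker (q n) z - h z) (ker p z) \<partial>?P)"
      unfolding inner_diff_left Bochner_Integration.integral_diff[OF i] ..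
    also have "\<dots> \<le> (\<integral>z. norm (inner (ker (q n) z - h z) (ker p z)) \<partial>?P)"
      by (rule integral_norm_bound)
    also have "\<dots> \<le> (\<integral>z. norm (ker (q n) z - h z) * b \<partial>?P)"
    proof (rule integral_mono)
      fix z
      have "norm (inner (ker (q n) z - h z) (ker p z)) \<le> norm (ker (q n) z - h z) * norm (ker p z)"
        using Cauchy_Schwarz_ineq2 by simp
      also have "\<dots> \<le> norm (ker (q n) z - h z) * b" by (intro mult_left_mono b) simp
      finally show "norm (inner (ker (q n) z - h z) (ker p z)) \<le> norm (ker (q n) z - h z) * b" .
      show "integrable ?P (\<lambda>z. norm (inner (ker (q n) z - h z) (ker p z)))"
        by (intro integrable_norm inner_ker_integrable p Bochner_Integration.integrable_diff ker_integrable q h)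
      show "integrable ?P (\<lambda>z. norm (ker (q n) z - h z) * b)"
        by (intro integrable_mult_left integrable_norm Bochner_Integration.integrable_diff ker_integrable q h)
    qed
    also have "\<dots> = (\<integral>z. norm (ker (q n) z - h z) \<partial>?P) * b" by (rule integral_mult_left_zero)
    finally show ?thesis .
  qed
  moreover have "(\<lambda>n. (\<integral>z. norm (ker (q n) z - h z) \<partial>?P) * b) \<longlonglongrightarrow> 0"
    by (rule tendsto_mult_left_zero[OF lim])
  ultimately have "(\<lambda>n. (\<integral>z. inner (ker (q n) z) (ker p z) \<partial>?P) - (\<integral>z. inner (h z) (ker p z) \<partial>?P)) \<longlonglongrightarrow> 0"
    by (rule Lim_null_comparison[OF always_eventually[OF allI]])
  then have "(\<lambda>n. \<integral>z. inner (ker (q n) z) (ker p z) \<partial>?P) \<longlonglongrightarrow> (\<integral>z. inner (h z) (ker p z) \<partial>?P)"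
    by (rule LIM_zero_cancel)
  with 1 show ?thesis by (rule LIMSEQ_unique[symmetric])
qed

text \<open>Test functions supported on \<open>{1 < norm h}\<close> and pointing in the direction of \<open>h\<close>.\<close>

lemma norm_representer_le_one:
  assumes q: "\<And>n. q n \<in> kernels" and h: "integrable (M1 \<Otimes>\<^sub>M M2) h"
    and ae: "AE z in M1 \<Otimes>\<^sub>M M2. (\<lambda>n. ker (q n) z) \<longlonglongrightarrow> h z"
    and rep: "\<And>p. p \<in> kernels \<Longrightarrow> (\<integral>z. inner (h z) (ker p z) \<partial>(M1 \<Otimes>\<^sub>M M2)) = inner 1 (app p)"
  shows "AE z in M1 \<Otimes>\<^sub>M M2. norm (h z) \<le> 1"
proof -
  let ?P = "M1 \<Otimes>\<^sub>M M2"
  \<comment> \<open>\<open>g\<close> vanishes up to 1, is positive beyond, and decays enough to keep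
    \<open>\<Psi>\<close> bounded. Continuity, which a plain cut-off at 1 would spoil, lets
    \<open>\<Psi>\<close> pass to the limit.\<close>
  define g :: "real \<Rightarrow> real" where "g r = max 0 (r - 1) / (1 + r)\<^sup>2" for r
  define \<Psi> :: "'k \<Rightarrow> 'k" where "\<Psi> w = g (norm w) *\<^sub>R w" for w
  have pos: "1 + norm w \<noteq> 0" for w :: 'k using norm_ge_zero[of w] by linarith
  have cont: "continuous_on UNIV \<Psi>"
    unfolding \<Psi>_def[abs_def] g_def using pos by (intro continuous_intros) auto
  then have [measurable]: "\<Psi> \<in> borel_measurable borel" by (rule borel_measurable_continuous_onI)
  have g0: "0 \<le> g r" if "0 \<le> r" for r using that by (simp add: g_def)
  have norm_\<Psi>: "norm (\<Psi> w) = g (norm w) * norm w" for w by (simp add: \<Psi>_def g0)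
  have \<Psi>_le: "norm (\<Psi> w) \<le> 1" for w
  proof -
    have "max 0 (norm w - 1) * norm w \<le> (1 + norm w) * (1 + norm w)" by (intro mult_mono) auto
    moreover have "0 < (1 + norm w)\<^sup>2" using pos[of w] by simp
    ultimately show ?thesis by (simp add: norm_\<Psi> g_def power2_eq_square)
  qed
  note [measurable] = borel_measurable_integrable[OF h] ker_measurable[OF q]
  \<comment> \<open>\<open>\<Psi>\<close> applied to \<open>h\<close> need not be a step kernel, but
    applied to \<open>ker (q n)\<close> it is one with the same cells. The test is made there, and
    dominated convergence carries it to \<open>h\<close>.\<close>
  define Q where "Q n = (\<lambda>j x. \<Psi> (fst (q n) j x), snd (q n))" for n
  have Q: "Q n \<in> kernels" for n
  proof -
    note [measurable] = kernelsD(1,2)[OF q]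
    show ?thesis unfolding Q_def kernels_def using \<Psi>_le by auto
  qed
  have ker_Q: "ker (Q n) z = \<Psi> (ker (q n) z)" for n z
    by (simp add: Q_def ker_def)
  have ae': "AE z in ?P. (\<lambda>n. \<Psi> (ker (q n) z)) \<longlonglongrightarrow> \<Psi> (h z)"
    using ae
  proof eventually_elim
    case (elim z)
    then show ?case using continuous_on_tendsto_compose[OF cont] by auto
  qed
  have inner_le: "norm (inner w (\<Psi> v)) \<le> norm w" for v w
  proof -
    have "norm (inner w (\<Psi> v)) \<le> norm w * norm (\<Psi> v)" using Cauchy_Schwarz_ineq2 by simp
    also have "\<dots> \<le> norm w * 1" by (intro mult_left_mono \<Psi>_le) simp
    finally show ?thesis by simp
  qed
  have "(\<lambda>n. \<integral>z. inner (h z) (\<Psi> (ker (q n) z)) \<partial>?P) \<longlonglongrightarrow> (\<integral>z. inner (h z) (\<Psi> (h z)) \<partial>?P)"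
  proof (rule integral_dominated_convergence[where w="\<lambda>z. norm (h z)"])
    show "AE z in ?P. (\<lambda>n. inner (h z) (\<Psi> (ker (q n) z))) \<longlonglongrightarrow> inner (h z) (\<Psi> (h z))"
      using ae' by eventually_elim (intro tendsto_intros)
  qed (use h inner_le in auto)
  moreover have "(\<lambda>n. \<integral>z. norm (\<Psi> (ker (q n) z)) \<partial>?P) \<longlonglongrightarrow> (\<integral>z. norm (\<Psi> (h z)) \<partial>?P)"
  proof (rule integral_dominated_convergence[where w="\<lambda>z. 1"])
    show "AE z in ?P. (\<lambda>n. norm (\<Psi> (ker (q n) z))) \<longlonglongrightarrow> norm (\<Psi> (h z))"
      using ae' by eventually_elim (intro tendsto_intros)
  qed (use \<Psi>_le in auto)
  moreover have "(\<integral>z. inner (h z) (\<Psi> (ker (q n) z)) \<partial>?P) \<le> (\<integral>z. norm (\<Psi> (ker (q n) z)) \<partial>?P)" for n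
    using rep[OF Q, of n] app_bound(2)[OF Q, of n] abs_inner_one_le[of "app (Q n)"] by (simp add: ker_Q)
  ultimately have le: "(\<integral>z. inner (h z) (\<Psi> (h z)) \<partial>?P) \<le> (\<integral>z. norm (\<Psi> (h z)) \<partial>?P)"
    by (intro LIMSEQ_le) auto
  have i1: "integrable ?P (\<lambda>z. inner (h z) (\<Psi> (h z)))"
    by (rule Bochner_Integration.integrable_bound[OF h]) (use inner_le in auto)
  have i2: "integrable ?P (\<lambda>z. norm (\<Psi> (h z)))"
    by (rule P.integrable_const_bound[of _ 1]) (use \<Psi>_le in auto)
  have nonneg: "0 \<le> inner w (\<Psi> w) - norm (\<Psi> w)" and pos': "norm w \<le> 1 \<or> 0 < inner w (\<Psi> w) - norm (\<Psi> w)" for w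
  proof -
    \<comment> \<open>This difference is positive where \<open>norm w\<close> exceeds 1 and zero
      elsewhere, while its integral along \<open>h\<close> is at most 0.\<close>
    have eq: "inner w (\<Psi> w) - norm (\<Psi> w) = g (norm w) * norm w * (norm w - 1)"
      by (simp add: norm_\<Psi>) (simp add: \<Psi>_def dot_square_norm power2_eq_square algebra_simps)
    have "0 < g (norm w) * norm w * (norm w - 1)" if "1 < norm w"
      using that pos[of w] by (auto simp: g_def intro!: mult_pos_pos divide_pos_pos)
    moreover have "g (norm w) = 0" if "norm w \<le> 1" using that by (simp add: g_def)
    ultimately show "0 \<le> inner w (\<Psi> w) - norm (\<Psi> w)" "norm w \<le> 1 \<or> 0 < inner w (\<Psi> w) - norm (\<Psi> w)"
      unfolding eq by (cases "norm w \<le> 1"; force)+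
  qed
  have "(\<integral>z. inner (h z) (\<Psi> (h z)) - norm (\<Psi> (h z)) \<partial>?P) \<le> 0" using le i1 i2 by simp
  moreover have "0 \<le> (\<integral>z. inner (h z) (\<Psi> (h z)) - norm (\<Psi> (h z)) \<partial>?P)"
    using nonneg by (intro integral_nonneg_AE) auto
  ultimately have "(\<integral>z. inner (h z) (\<Psi> (h z)) - norm (\<Psi> (h z)) \<partial>?P) = 0" by simp
  then have "AE z in ?P. inner (h z) (\<Psi> (h z)) - norm (\<Psi> (h z)) = 0"
    using i1 i2 nonneg by (subst (asm) integral_nonneg_eq_0_iff_AE) auto
  then show ?thesis
    by eventually_elim (use pos' in force)
qed

text \<open>The minimiser represents only the real part of \<open>app\<close>, and through an inner
  product. Conjugating it gives a product, and testing on all scalar multiples of \<open>p\<close>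
  recovers the full scalar value.\<close>

lemma kernel_exists:
  obtains h where "h \<in> borel_measurable (M1 \<Otimes>\<^sub>M M2)" "\<And>z. norm (h z) \<le> 1"
    "\<And>p. p \<in> kernels \<Longrightarrow> (\<integral>z. ker p z * h z \<partial>(M1 \<Otimes>\<^sub>M M2)) = app p"
proof -
  let ?P = "M1 \<Otimes>\<^sub>M M2"
  obtain q h0 I where q: "\<And>n. q n \<in> kernels" and h0: "integrable ?P h0"
    and I: "\<And>p. p \<in> kernels \<Longrightarrow> I \<le> energy p" "\<And>n. energy (q n) \<le> I + (1/4) ^ n"
    and lim: "(\<lambda>n. \<integral>z. norm (ker (q n) z - h0 z) \<partial>?P) \<longlonglongrightarrow> 0"
    and ae: "AE z in ?P. (\<lambda>n. ker (q n) z) \<longlonglongrightarrow> h0 z"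
    using minimizing_sequence by blast
  have rep: "(\<integral>z. inner (h0 z) (ker p z) \<partial>?P) = inner 1 (app p)" if "p \<in> kernels" for p
    by (rule minimizer_represents[OF q h0 I lim that])
  have le1: "AE z in ?P. norm (h0 z) \<le> 1"
    by (rule norm_representer_le_one[OF q h0 ae rep])
  note [measurable] = borel_measurable_integrable[OF h0]
  \<comment> \<open>The cut-off on the exceptional null set makes the bound hold everywhere, hence
    on every section.\<close>
  define h where "h z = (if norm (h0 z) \<le> 1 then conj_of (h0 z) else 0)" for z
  have hm [measurable]: "h \<in> borel_measurable ?P"
    unfolding h_def[abs_def] conj_of_def by measurable
  have h_le: "norm (h z) \<le> 1" for z by (simp add: h_def)
  have int: "integrable ?P (\<lambda>z. ker p z * h z)" if p: "p \<in> kernels" for p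
  proof (rule Bochner_Integration.integrable_bound)
    note [measurable] = ker_measurable[OF p]
    show "(\<lambda>z. ker p z * h z) \<in> borel_measurable ?P" by measurable
    show "integrable ?P (ker p)" using p by simp
    show "AE z in ?P. norm (ker p z * h z) \<le> norm (ker p z)"
      using h_le by (simp add: norm_mult mult_left_le)
  qed
  have real_part: "inner 1 (\<integral>z. ker p z * h z \<partial>?P) = inner 1 (app p)" if p: "p \<in> kernels" for p
  proof -
    note [measurable] = ker_measurable[OF p]
    have "inner 1 (\<integral>z. ker p z * h z \<partial>?P) = (\<integral>z. inner 1 (ker p z * h z) \<partial>?P)"
      using int[OF p] by simp
    also have "\<dots> = (\<integral>z. inner (h0 z) (ker p z) \<partial>?P)"
    proof (rule integral_cong_AE)
      show "AE z in ?P. inner 1 (ker p z * h z) = inner (h0 z) (ker p z)"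
        using le1
      proof eventually_elim
        case (elim z)
        then show ?case
          using inner_one_conj_of[of "h0 z" "ker p z"] by (simp add: h_def mult.commute)
      qed
    qed measurable
    finally show ?thesis using rep[OF p] by simp
  qed
  have "(\<integral>z. ker p z * h z \<partial>?P) = app p" if p: "p \<in> kernels" for p
  proof -
    have "inner 1 (c * ((\<integral>z. ker p z * h z \<partial>?P) - app p)) = 0" for c
    proof -
      \<comment> \<open>\<open>lin c p 0 p\<close> is just \<open>c\<close> times \<open>p\<close>;
        the second slot has weight zero.\<close>
      have "(\<integral>z. ker (lin c p 0 p) z * h z \<partial>?P) = c * (\<integral>z. ker p z * h z \<partial>?P)"
        using int[OF p] by (simp add: ker_lin mult.assoc)
      then show ?thesis
        using real_part[OF lin_kernels[OF p p, of c 0]] by (simp add: app_lin[OF p p] right_diff_distrib inner_diff_right)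
    qed
    then show ?thesis using inner_one_mult_eq_zero by fastforce
  qed
  with hm h_le show ?thesis by (rule that)
qed

section \<open>From test kernels to all integrable functions\<close>

lemma representation_bounded:
  assumes [measurable]: "h \<in> borel_measurable (M1 \<Otimes>\<^sub>M M2)" and le: "\<And>z. norm (h z) \<le> 1"
    and rep: "\<And>p. p \<in> kernels \<Longrightarrow> (\<integral>z. ker p z * h z \<partial>(M1 \<Otimes>\<^sub>M M2)) = app p"
    and u [measurable]: "u \<in> borel_measurable M2" and b: "\<And>x. norm (u x) \<le> b"
  shows "AE t in M1. T u t = (\<integral>x. u x * h (t, x) \<partial>M2)"
proof -
  let ?P = "M1 \<Otimes>\<^sub>M M2"
  have uint: "integrable M2 u"
    by (rule M2.integrable_const_bound[of _ b]) (use b in auto)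
  have b0: "0 \<le> b" using b[of undefined] norm_ge_zero order_trans by blast
  have int: "integrable ?P (\<lambda>z. u (snd z) * h z)"
  proof (rule P.integrable_const_bound)
    have "norm (u (snd z)) * norm (h z) \<le> b * 1" for z
      using b0 by (intro mult_mono b le) auto
    then show "AE z in ?P. norm (u (snd z) * h z) \<le> b" by (simp add: norm_mult)
  qed measurable
  show ?thesis
  proof (rule AE_eq_if_set_integrals_eq)
    show "integrable M1 (\<lambda>t. \<integral>x. u x * h (t, x) \<partial>M2)"
      using integrable_fst'[OF int] by simp
    have m [measurable]: "T u \<in> borel_measurable M1" by (rule T_measurable[OF uint])
    show "integrable M1 (T u)"
      by (rule M1.integrable_const_bound[OF T_bound[OF uint] m])
    fix C assume C [measurable]: "C \<in> sets M1"
    \<comment> \<open>The product of the indicator of \<open>C\<close> with \<open>u\<close>, as a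
      pair: cell 1 is \<open>C\<close>, and cell 0 is its complement, carrying the zero function.
      \<open>T\<close> maps that function to zero only almost everywhere.\<close>
    define p :: "(nat \<Rightarrow> 'a \<Rightarrow> 'k) \<times> ('b \<Rightarrow> nat)" where
      "p = (\<lambda>j x. if j = 1 then u x else 0, \<lambda>t. if t \<in> C then 1 else 0)"
    have p: "p \<in> kernels"
      unfolding p_def kernels_def using b b0 by (auto intro!: exI[of _ b])
    have ker_p: "ker p z = indicator C (fst z) *\<^sub>R u (snd z)" for z
      by (simp add: ker_def p_def)
    have "AE t in M1. T (\<lambda>x. 0) t = 0"
      using T_bound[of "\<lambda>x. 0"] by simp
    then have "AE t in M1. T (fst p (snd p t)) t = indicator C t *\<^sub>R T u t"
      by eventually_elim (simp add: p_def indicator_def)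
    then have "app p = (\<integral>t. indicator C t *\<^sub>R T u t \<partial>M1)"
      unfolding app_def using app_bound(1)[OF p] by (intro integral_cong_AE) auto
    moreover have "(\<integral>z. ker p z * h z \<partial>?P) = (\<integral>t. indicator C t *\<^sub>R (\<integral>x. u x * h (t, x) \<partial>M2) \<partial>M1)"
    proof -
      have "integrable ?P (\<lambda>z. indicator (C \<times> space M2) z *\<^sub>R (u (snd z) * h z))"
        by (intro integrable_mult_indicator int) measurable
      then have "integrable ?P (\<lambda>z. ker p z * h z)"
        by (rule Bochner_Integration.integrable_cong[THEN iffD1, rotated -1])
          (auto simp: ker_p space_pair_measure indicator_def)
      from integral_fst'[OF this] show ?thesis
        by (simp add: ker_p)
    qed
    ultimately show "(\<integral>t. indicator C t *\<^sub>R T u t \<partial>M1) = (\<integral>t. indicator C t *\<^sub>R (\<integral>x. u x * h (t, x) \<partial>M2) \<partial>M1)"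
      using rep[OF p] by simp
  qed
qed

lemma T_diff:
  assumes u: "integrable M2 u" and v: "integrable M2 v"
  shows "AE t in M1. T (\<lambda>x. u x - v x) t = T u t - T v t"
  using T_add[of "\<lambda>x. u x - v x" v] u v by (auto elim!: eventually_mono)

text \<open>Truncation reduces to bounded functions. Both sides are contractive in the L_1 norm, so
  the error is at most twice the norm of the truncated part; indexing by naturals lets one null set
  serve all truncations.\<close>

lemma representation:
  obtains h where "h \<in> borel_measurable (M1 \<Otimes>\<^sub>M M2)" "\<And>z. norm (h z) \<le> 1"
    "\<And>u. integrable M2 u \<Longrightarrow> AE t in M1. T u t = (\<integral>x. u x * h (t, x) \<partial>M2)"
proof -
  obtain h where h [measurable]: "h \<in> borel_measurable (M1 \<Otimes>\<^sub>M M2)" and le: "\<And>z. norm (h z) \<le> 1"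
    and rep: "\<And>p. p \<in> kernels \<Longrightarrow> (\<integral>z. ker p z * h z \<partial>(M1 \<Otimes>\<^sub>M M2)) = app p"
    using kernel_exists by blast
  have "AE t in M1. T u t = (\<integral>x. u x * h (t, x) \<partial>M2)" if u: "integrable M2 u" for u
  proof -
    note [measurable] = borel_measurable_integrable[OF u]
    define v where "v n x = (if norm (u x) \<le> real n then u x else 0)" for n x
    have [measurable]: "v n \<in> borel_measurable M2" for n unfolding v_def[abs_def] by measurable
    have v: "integrable M2 (v n)" for n
      by (rule Bochner_Integration.integrable_bound[OF u]) (auto simp: v_def)
    have 1: "AE t in M1. \<forall>n. T (v n) t = (\<integral>x. v n x * h (t, x) \<partial>M2)"
      unfolding AE_all_countable
      by (intro allI representation_bounded[OF h le rep, where b="real n" for n]) (auto simp: v_def)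
    have 2: "AE t in M1. \<forall>n. T (\<lambda>x. u x - v n x) t = T u t - T (v n) t"
      unfolding AE_all_countable by (intro allI T_diff u v)
    have 3: "AE t in M1. \<forall>n. norm (T (\<lambda>x. u x - v n x) t) \<le> (\<integral>x. norm (u x - v n x) \<partial>M2)"
      unfolding AE_all_countable using u v by (intro allI T_bound) auto
    have "(\<lambda>n. \<integral>x. norm (u x - v n x) \<partial>M2) \<longlonglongrightarrow> (\<integral>x. 0 \<partial>M2)"
    proof (rule integral_dominated_convergence[where w="\<lambda>x. norm (u x)"])
      show "AE x in M2. (\<lambda>n. norm (u x - v n x)) \<longlonglongrightarrow> 0"
      proof (rule AE_I2)
        fix x
        obtain N where "norm (u x) \<le> real N" using real_arch_simple by blast
        then have "norm (u x - v n x) = 0" if "n \<ge> N" for n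
          using that by (simp add: v_def)
        then show "(\<lambda>n. norm (u x - v n x)) \<longlonglongrightarrow> 0"
          by (intro tendsto_eventually) (auto simp: eventually_sequentially)
      qed
      show "AE x in M2. norm (norm (u x - v n x)) \<le> norm (u x)" for n
        by (simp add: v_def)
    qed (use u in auto)
    then have lim: "(\<lambda>n. 2 * (\<integral>x. norm (u x - v n x) \<partial>M2)) \<longlonglongrightarrow> 0"
      using tendsto_mult_right_zero by fastforce
    show ?thesis
      using 1 2 3 AE_space
    proof eventually_elim
      case (elim t)
      have int: "integrable M2 (\<lambda>x. w x * h (t, x))" if "integrable M2 w" for w
        by (rule section_integrable[OF h le that]) (rule elim)
      have "norm (T u t - (\<integral>x. u x * h (t, x) \<partial>M2)) \<le> 2 * (\<integral>x. norm (u x - v n x) \<partial>M2)" for n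
      proof -
        have "(\<integral>x. u x * h (t, x) \<partial>M2) - (\<integral>x. v n x * h (t, x) \<partial>M2) = (\<integral>x. (u x - v n x) * h (t, x) \<partial>M2)"
          using int[OF u] int[OF v] by (simp add: left_diff_distrib)
        moreover have "norm (\<integral>x. (u x - v n x) * h (t, x) \<partial>M2) \<le> (\<integral>x. norm (u x - v n x) \<partial>M2)"
        proof -
          have "norm (\<integral>x. (u x - v n x) * h (t, x) \<partial>M2) \<le> (\<integral>x. norm ((u x - v n x) * h (t, x)) \<partial>M2)"
            by (rule integral_norm_bound)
          also have "\<dots> \<le> (\<integral>x. norm (u x - v n x) \<partial>M2)"
            using u v le
            by (intro integral_mono integrable_norm int Bochner_Integration.integrable_diff)
              (simp_all add: norm_mult mult_left_le)
          finally show ?thesis .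
        qed
        moreover have "T u t - (\<integral>x. v n x * h (t, x) \<partial>M2) = T (\<lambda>x. u x - v n x) t"
          using elim by simp
        moreover have "T u t - (\<integral>x. u x * h (t, x) \<partial>M2) = (T u t - (\<integral>x. v n x * h (t, x) \<partial>M2))
          - ((\<integral>x. u x * h (t, x) \<partial>M2) - (\<integral>x. v n x * h (t, x) \<partial>M2))" by simp
        ultimately show ?thesis
          using elim(3)[rule_format, of n] norm_triangle_ineq4[of "T (\<lambda>x. u x - v n x) t" "\<integral>x. (u x - v n x) * h (t, x) \<partial>M2"]
          by simp
      qed
      then have "norm (T u t - (\<integral>x. u x * h (t, x) \<partial>M2)) \<le> 0"
        by (intro LIMSEQ_le_const[OF lim]) auto
      then show ?case by simp
    qed
  qed
  with h le show ?thesis by (rule that)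
qed

subsection \<open>Perturbation of the kernel\<close>

text \<open>Together with \<open>norm (k z) \<le> 1\<close>, the last conclusion says that the
  integral of \<open>k\<close> over \<open>A\<close> has essential supremum exactly
  \<open>measure M2 A\<close>. It holds because \<open>k\<close> is 1 on \<open>W\<close>, which
  nearly fills \<open>C \<times> A\<close> for suitable \<open>C\<close>.\<close>

lemma perturbed_kernel:
  assumes \<eta>: "0 < \<eta>" "AE t in M1. 1 - \<eta> \<le> inner 1 (T (\<lambda>_. 1) t)" and \<delta>: "0 < \<delta>"
  obtains h k A where "h \<in> borel_measurable (M1 \<Otimes>\<^sub>M M2)" "k \<in> borel_measurable (M1 \<Otimes>\<^sub>M M2)"
    "\<And>z. norm (h z) \<le> 1" "\<And>z. norm (k z) \<le> 1" "\<And>z. norm (k z - h z) \<le> \<delta>"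
    "\<And>u. integrable M2 u \<Longrightarrow> AE t in M1. T u t = (\<integral>x. u x * h (t, x) \<partial>M2)"
    "A \<in> sets M2" "1 - 12 * \<eta> / \<delta>\<^sup>2 \<le> measure M2 A"
    "\<And>L. AE t in M1. norm (\<integral>x. indicator A x *\<^sub>R k (t, x) \<partial>M2) \<le> L \<Longrightarrow> measure M2 A \<le> L"
proof -
  let ?P = "M1 \<Otimes>\<^sub>M M2"
  obtain h where h [measurable]: "h \<in> borel_measurable ?P" and h_le: "\<And>z. norm (h z) \<le> 1"
    and rep: "\<And>u. integrable M2 u \<Longrightarrow> AE t in M1. T u t = (\<integral>x. u x * h (t, x) \<partial>M2)"
    using representation by blast
  define W where "W = {z \<in> space ?P. norm (h z - 1) \<le> \<delta>}"
  have W [measurable]: "W \<in> sets ?P" unfolding W_def by measurable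
  define k where "k z = (if norm (h z - 1) \<le> \<delta> then 1 else h z)" for z
  have k [measurable]: "k \<in> borel_measurable ?P" unfolding k_def[abs_def] by measurable
  have k_le: "norm (k z) \<le> 1" and kh: "norm (k z - h z) \<le> \<delta>" for z
    using h_le \<delta> by (auto simp: k_def norm_minus_commute)
  have int_h: "integrable ?P h" by (rule P.integrable_const_bound[of _ 1]) (use h_le in auto)
  have int_k: "integrable ?P k" by (rule P.integrable_const_bound[of _ 1]) (use k_le in auto)
  have "1 - \<eta> = (\<integral>t. 1 - \<eta> \<partial>M1)" by (simp add: M1.prob_space)
  also have "\<dots> \<le> (\<integral>t. inner 1 (\<integral>x. h (t, x) \<partial>M2) \<partial>M1)"
  proof (rule integral_mono_AE)
    show "integrable M1 (\<lambda>t. inner 1 (\<integral>x. h (t, x) \<partial>M2))"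
      using integrable_fst'[OF int_h] by simp
    show "AE t in M1. 1 - \<eta> \<le> inner 1 (\<integral>x. h (t, x) \<partial>M2)"
      using \<eta>(2) rep[of "\<lambda>_. 1"] by auto
  qed simp
  also have "\<dots> = inner 1 (\<integral>z. h z \<partial>?P)"
    using integral_fst'[OF int_h] integrable_fst'[OF int_h] by simp
  finally have int_ge: "1 - \<eta> \<le> inner 1 (\<integral>z. h z \<partial>?P)" .
  have pw: "\<delta>\<^sup>2 * indicator (space ?P - W) z \<le> 2 - 2 * inner 1 (h z)" for z
  proof -
    \<comment> \<open>Inside the unit ball the deviation from 1 is controlled by the real part
      alone. Chebyshev's inequality then bounds the complement of \<open>W\<close> by
      \<open>2 * \<eta> / \<delta>\<^sup>2\<close>.\<close>
    have sq: "(norm (h z - 1))\<^sup>2 \<le> 2 - 2 * inner 1 (h z)"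
      using power_mono[OF h_le[of z], of 2] dot_norm_neg[of 1 "h z"] by (simp add: norm_minus_commute)
    show ?thesis
    proof (cases "z \<in> space ?P - W")
      case True
      then have "\<delta>\<^sup>2 \<le> (norm (h z - 1))\<^sup>2"
        using \<delta> by (intro power_mono) (auto simp: W_def)
      with sq True show ?thesis by simp
    next
      case False
      moreover have "0 \<le> 2 - 2 * inner 1 (h z)"
        using sq zero_le_power2[of "norm (h z - 1)"] by linarith
      ultimately show ?thesis by simp
    qed
  qed
  have int_ind: "integrable ?P (indicator X :: _ \<Rightarrow> real)" if "X \<in> sets ?P" for X
    using that by (intro P.integrable_const_bound[of _ 1]) (auto simp: indicator_def)
  have "\<delta>\<^sup>2 * measure ?P (space ?P - W) = (\<integral>z. \<delta>\<^sup>2 * indicator (space ?P - W) z \<partial>?P)"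
    by simp
  also have "\<dots> \<le> (\<integral>z. 2 - 2 * inner 1 (h z) \<partial>?P)"
    using int_h pw int_ind[of "space ?P - W"] by (intro integral_mono integrable_mult_right) auto
  also have "\<dots> = 2 - 2 * inner 1 (\<integral>z. h z \<partial>?P)"
    using int_h by (simp add: P.prob_space)
  also have "\<dots> \<le> 2 * \<eta>" using int_ge by simp
  finally have "measure ?P (space ?P - W) \<le> 2 * \<eta> / \<delta>\<^sup>2"
    using \<delta> by (simp add: field_simps)
  moreover have "0 < 2 * \<eta> / \<delta>\<^sup>2" using \<eta>(1) \<delta> by simp
  ultimately obtain A where A [measurable]: "A \<in> sets M2" and A_ge: "1 - 6 * (2 * \<eta> / \<delta>\<^sup>2) \<le> measure M2 A"
    and conc: "\<And>e. 0 < e \<Longrightarrow> \<exists>C\<in>sets M1. 0 < measure M1 C \<and> measure ?P (C \<times> A - W) \<le> e * measure M1 C"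
    using concentrate[OF W] by metis
  have "measure M2 A \<le> L" if L: "AE t in M1. norm (\<integral>x. indicator A x *\<^sub>R k (t, x) \<partial>M2) \<le> L" for L
  proof (rule field_le_epsilon)
    fix e :: real assume "0 < e"
    then have "0 < e / 2" by simp
    from conc[OF this] obtain C where C [measurable]: "C \<in> sets M1" and C0: "0 < measure M1 C"
      and CW: "measure ?P (C \<times> A - W) \<le> e / 2 * measure M1 C" by blast
    have i1: "integrable ?P (\<lambda>z. indicator (C \<times> A) z *\<^sub>R k z)"
      by (intro integrable_mult_indicator int_k) measurable
    \<comment> \<open>Off \<open>W\<close> the real part of \<open>k\<close> may drop from 1 to -1,
      a loss of 2; this is why \<open>conc\<close> was used with \<open>e / 2\<close>.\<close>
    have "indicator (C \<times> A) z - 2 * indicator (C \<times> A - W) z \<le> inner 1 (indicator (C \<times> A) z *\<^sub>R k z)" for z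
    proof -
      have "-1 \<le> inner 1 (k z)" using abs_inner_one_le[of "k z"] k_le[of z] by linarith
      moreover have "k z = 1" if "z \<in> W" using that by (simp add: W_def k_def)
      ultimately show ?thesis by (auto simp: indicator_def dot_square_norm)
    qed
    then have "(\<integral>z. indicator (C \<times> A) z - 2 * indicator (C \<times> A - W) z \<partial>?P)
        \<le> (\<integral>z. inner 1 (indicator (C \<times> A) z *\<^sub>R k z) \<partial>?P)"
      using i1 int_ind[of "C \<times> A"] int_ind[of "C \<times> A - W"] by (intro integral_mono integrable_inner_right) auto
    moreover have "(\<integral>z. indicator (C \<times> A) z - 2 * indicator (C \<times> A - W) z \<partial>?P)
        = measure M1 C * measure M2 A - 2 * measure ?P (C \<times> A - W)"
      using int_ind[of "C \<times> A"] int_ind[of "C \<times> A - W"] by (simp add: measure_Times)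
    moreover have "(\<integral>z. inner 1 (indicator (C \<times> A) z *\<^sub>R k z) \<partial>?P) \<le> (\<integral>t. indicator C t * L \<partial>M1)"
    proof -
      have eq: "(\<integral>x. indicator (C \<times> A) (t, x) *\<^sub>R k (t, x) \<partial>M2)
          = indicator C t *\<^sub>R (\<integral>x. indicator A x *\<^sub>R k (t, x) \<partial>M2)" for t
        by (cases "t \<in> C") (simp_all add: indicator_times)
      have "(\<integral>z. inner 1 (indicator (C \<times> A) z *\<^sub>R k z) \<partial>?P)
          = inner 1 (\<integral>z. indicator (C \<times> A) z *\<^sub>R k z \<partial>?P)"
        by (rule integral_inner_right) (rule i1)
      also have "\<dots> = inner 1 (\<integral>t. indicator C t *\<^sub>R (\<integral>x. indicator A x *\<^sub>R k (t, x) \<partial>M2) \<partial>M1)"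
        using integral_fst'[OF i1] by (simp add: eq)
      also have "\<dots> \<le> norm (\<integral>t. indicator C t *\<^sub>R (\<integral>x. indicator A x *\<^sub>R k (t, x) \<partial>M2) \<partial>M1)"
        using abs_inner_one_le abs_le_D1 by blast
      also have "\<dots> \<le> (\<integral>t. norm (indicator C t *\<^sub>R (\<integral>x. indicator A x *\<^sub>R k (t, x) \<partial>M2)) \<partial>M1)"
        by (rule integral_norm_bound)
      also have "\<dots> \<le> (\<integral>t. indicator C t * L \<partial>M1)"
      proof (rule integral_mono_AE)
        show "integrable M1 (\<lambda>t. norm (indicator C t *\<^sub>R (\<integral>x. indicator A x *\<^sub>R k (t, x) \<partial>M2)))"
          using integrable_fst'[OF i1] unfolding eq by (rule integrable_norm)
        show "AE t in M1. norm (indicator C t *\<^sub>R (\<integral>x. indicator A x *\<^sub>R k (t, x) \<partial>M2)) \<le> indicator C t * L"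
          using L by eventually_elim (auto simp: indicator_def)
        show "integrable M1 (\<lambda>t. indicator C t * L)"
          by (rule M1.integrable_const_bound[of _ "\<bar>L\<bar>"]) (auto simp: indicator_def)
      qed
      finally show ?thesis .
    qed
    ultimately have "measure M1 C * measure M2 A - 2 * measure ?P (C \<times> A - W) \<le> measure M1 C * L"
      by simp
    with CW have "measure M1 C * measure M2 A \<le> measure M1 C * (L + e)"
      by (simp add: algebra_simps)
    with C0 show "measure M2 A \<le> L + e" by simp
  qed
  with h k h_le k_le kh rep A A_ge show ?thesis by (intro that[of h k A]) auto
qed

end

section \<open>Localisation and norm attainment for operators on functions\<close>

lemma inverse_sgn_mult: "inverse (sgn z) * z = of_real (norm (z :: 'k::real_normed_field))"
  by (cases "z = 0") (simp_all add: sgn_div_norm scaleR_conv_of_real field_simps)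

text \<open>The left side is the mass lost in \<open>perturbed_kernel\<close> for
  \<open>\<delta> = e / 2\<close> and \<open>\<eta> = (e / 10) ^ 8\<close>. The same inequality
  holds with any \<open>\<eta>\<close> up to \<open>e ^ 3 / 192\<close>, so there is a large
  margin.\<close>

lemma modulus_estimate:
  fixes e :: real
  assumes "0 < e" "e < 1"
  shows "12 * (e / 10) ^ 8 / (e / 2)\<^sup>2 \<le> e / 4"
proof -
  have "12 * (e / 10) ^ 8 / (e / 2)\<^sup>2 = 48 / 10 ^ 8 * e ^ 5 * e"
    using assms by (simp add: field_simps eval_nat_numeral)
  also have "\<dots> \<le> 1 / 4 * e"
    using assms power_le_one[of e 5] by (intro mult_right_mono) auto
  finally show ?thesis by simp
qed

text \<open>The operator is altered only in its values on \<open>B\<close> and only through the part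
  of a function living where \<open>f0\<close> is nonzero. Since L_1 norms of functions with
  disjoint supports add, it remains a contraction.\<close>

lemma norm_attaining_perturbation:
  fixes \<mu> :: "'a measure" and \<nu> :: "'b measure"
    and \<tau> :: "('a \<Rightarrow> 'k::{real_normed_field, euclidean_space}) \<Rightarrow> 'b \<Rightarrow> 'k"
  assumes semi: "semifinite \<nu>"
    and \<tau>: "L1_contraction \<nu> \<mu> \<tau>"
    and f0: "integrable \<mu> f0" "(\<integral>x. norm (f0 x) \<partial>\<mu>) = 1"
    and e: "0 < e" "e < 1"
    and big: "\<not> (AE t in \<nu>. norm (\<tau> f0 t) \<le> 1 - (e / 10) ^ 8)"
  obtains \<sigma> g where "L1_contraction \<nu> \<mu> \<sigma>"
    "\<forall>f. integrable \<mu> f \<longrightarrow> (AE t in \<nu>. norm (\<sigma> f t - \<tau> f t) \<le> e / 2 * (\<integral>x. norm (f x) \<partial>\<mu>))"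
    "integrable \<mu> g" "(\<integral>x. norm (g x) \<partial>\<mu>) = 1" "(\<integral>x. norm (g x - f0 x) \<partial>\<mu>) < e"
    "\<forall>L. (AE t in \<nu>. norm (\<sigma> g t) \<le> L) \<longrightarrow> 1 \<le> L"
proof -
  note \<tau>_measurable = L1_contraction.T_measurable[OF \<tau>] and \<tau>_add = L1_contraction.T_add[OF \<tau>]
    and \<tau>_scale = L1_contraction.T_scale[OF \<tau>] and \<tau>_bound = L1_contraction.T_bound[OF \<tau>]
  define \<eta> where "\<eta> = (e / 10) ^ 8"
  have \<eta>: "0 < \<eta>" "\<eta> < 1" using e by (simp_all add: \<eta>_def power_less_one_iff)
  note [measurable] = borel_measurable_integrable[OF f0(1)] \<tau>_measurable[OF f0(1)]
  obtain B where B [measurable]: "B \<in> sets \<nu>" and B_pos: "0 < emeasure \<nu> B" and B_fin: "emeasure \<nu> B < \<infinity>"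
    and B_big: "\<And>t. t \<in> B \<Longrightarrow> 1 - \<eta> < norm (\<tau> f0 t)"
  proof -
    let ?B = "{t \<in> space \<nu>. \<not> norm (\<tau> f0 t) \<le> 1 - \<eta>}"
    have [measurable]: "?B \<in> sets \<nu>" by measurable
    have pos: "emeasure \<nu> ?B \<noteq> 0"
      using big AE_iff_measurable[of ?B \<nu> "\<lambda>t. norm (\<tau> f0 t) \<le> 1 - \<eta>"] by (auto simp: \<eta>_def)
    show ?thesis
    proof (cases "emeasure \<nu> ?B = \<infinity>")
      case True
      then obtain B where "B \<in> sets \<nu>" "B \<subseteq> ?B" "0 < emeasure \<nu> B" "emeasure \<nu> B < \<infinity>"
        using semi unfolding semifinite_def by (metis (no_types, lifting) \<open>?B \<in> sets \<nu>\<close>)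
      then show ?thesis by (intro that[of B]) auto
    next
      case False
      then show ?thesis
        using pos by (intro that[of ?B]) (auto simp: less_top zero_less_iff_neq_zero)
    qed
  qed
  define M1 where "M1 = uniform_measure \<nu> B"
  \<comment> \<open>A probability measure whatever \<mu> is, because \<open>f0\<close> has norm one.
    Multiplication by \<open>f0\<close> maps its integrable functions isometrically into those of
    \<mu>, the constant 1 going to \<open>f0\<close>; the phase of \<open>f0\<close> is absorbed by
    the operator.\<close>
  define M2 where "M2 = density \<mu> (\<lambda>x. ennreal (norm (f0 x)))"
  have sets_M [measurable_cong, simp]: "sets M1 = sets \<nu>" "sets M2 = sets \<mu>"
    by (simp_all add: M1_def M2_def)
  interpret M1: prob_space M1
    unfolding M1_def using B_pos B_fin by (intro prob_space_uniform_measure) auto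
  interpret M2: prob_space M2
  proof
    have "emeasure M2 (space M2) = (\<integral>\<^sup>+x. ennreal (norm (f0 x)) \<partial>\<mu>)"
      unfolding M2_def by (subst emeasure_density) (auto intro!: nn_integral_cong simp: indicator_def)
    also have "\<dots> = 1"
      using f0 by (subst nn_integral_eq_integral) auto
    finally show "emeasure M2 (space M2) = 1" .
  qed
  interpret pair_prob_space M1 M2 ..
  have AE_M1: "(AE t in M1. P t) \<longleftrightarrow> (AE t in \<nu>. t \<in> B \<longrightarrow> P t)" for P
    unfolding M1_def using B_pos B_fin by (intro AE_uniform_measure) auto
  have integrable_M2: "integrable M2 u \<longleftrightarrow> integrable \<mu> (\<lambda>x. u x * f0 x)" if "u \<in> borel_measurable \<mu>" for u :: "'a \<Rightarrow> 'k"
  proof -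
    note [measurable] = that
    have "integrable M2 u \<longleftrightarrow> integrable \<mu> (\<lambda>x. norm (f0 x) *\<^sub>R u x)"
      unfolding M2_def by (intro integrable_density) auto
    also have "\<dots> \<longleftrightarrow> integrable \<mu> (\<lambda>x. norm (norm (f0 x) *\<^sub>R u x))"
      by (rule integrable_norm_iff[symmetric]) measurable
    also have "\<dots> \<longleftrightarrow> integrable \<mu> (\<lambda>x. norm (u x * f0 x))"
      by (simp add: norm_mult mult.commute)
    also have "\<dots> \<longleftrightarrow> integrable \<mu> (\<lambda>x. u x * f0 x)"
      by (rule integrable_norm_iff) measurable
    finally show ?thesis .
  qed
  have integral_norm_M2: "(\<integral>x. norm (u x) \<partial>M2) = (\<integral>x. norm (u x * f0 x) \<partial>\<mu>)"
    if [measurable]: "u \<in> borel_measurable \<mu>" for u :: "'a \<Rightarrow> 'k"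
    unfolding M2_def by (subst integral_density) (auto simp: norm_mult mult.commute)
  define \<alpha> where "\<alpha> t = sgn (\<tau> f0 t)" for t
  have \<alpha>_norm: "norm (\<alpha> t) = 1" if "t \<in> B" for t
    using B_big[OF that] \<eta> by (auto simp: \<alpha>_def norm_sgn)
  have [measurable]: "\<alpha> \<in> borel_measurable \<nu>"
    unfolding \<alpha>_def[abs_def] sgn_div_norm by measurable
  \<comment> \<open>Dividing by the phase \<open>\<alpha>\<close> makes the value at the constant 1
    real and equal to \<open>norm (\<tau> f0 t)\<close>, hence larger than \<open>1 - \<eta>\<close>
    on \<open>B\<close>.\<close>
  define T where "T u t = inverse (\<alpha> t) * \<tau> (\<lambda>x. u x * f0 x) t" for u t
  interpret dominated_op M1 M2 T
  proof
    fix u v :: "'a \<Rightarrow> 'k" and c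
    assume u: "integrable M2 u"
    then have um [measurable]: "u \<in> borel_measurable \<mu>"
      using borel_measurable_integrable[OF u] by simp
    then have uf: "integrable \<mu> (\<lambda>x. u x * f0 x)" using u integrable_M2 by blast
    note [measurable] = \<tau>_measurable[OF uf]
    show "T u \<in> borel_measurable M1"
      unfolding T_def[abs_def] by measurable
    show "AE t in M1. T (\<lambda>x. c * u x) t = c * T u t"
      unfolding AE_M1 using \<tau>_scale[OF uf, of c] by eventually_elim (simp add: T_def mult.assoc)
    show "AE t in M1. norm (T u t) \<le> (\<integral>x. norm (u x) \<partial>M2)"
      unfolding AE_M1 integral_norm_M2[OF um] using \<tau>_bound[OF uf]
      by eventually_elim (simp add: T_def norm_mult norm_inverse \<alpha>_norm)
    assume v: "integrable M2 v"
    then have "v \<in> borel_measurable \<mu>"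
      using borel_measurable_integrable[OF v] by simp
    then have vf: "integrable \<mu> (\<lambda>x. v x * f0 x)" using v integrable_M2 by blast
    show "AE t in M1. T (\<lambda>x. u x + v x) t = T u t + T v t"
      unfolding AE_M1 using \<tau>_add[OF uf vf] by eventually_elim (simp add: T_def distrib_left distrib_right)
  qed
  have lower: "AE t in M1. 1 - \<eta> \<le> inner 1 (T (\<lambda>_. 1) t)"
    unfolding AE_M1
  proof (rule AE_I2, rule impI)
    fix t assume "t \<in> B"
    then show "1 - \<eta> \<le> inner 1 (T (\<lambda>_. 1) t)"
      using B_big[of t] by (simp add: T_def \<alpha>_def inverse_sgn_mult of_real_def dot_square_norm)
  qed
  obtain h k A where h [measurable]: "h \<in> borel_measurable (M1 \<Otimes>\<^sub>M M2)"
    and k [measurable]: "k \<in> borel_measurable (M1 \<Otimes>\<^sub>M M2)"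
    and h_le: "\<And>z. norm (h z) \<le> 1" and k_le: "\<And>z. norm (k z) \<le> 1" and kh: "\<And>z. norm (k z - h z) \<le> e / 2"
    and rep: "\<And>u. integrable M2 u \<Longrightarrow> AE t in M1. T u t = (\<integral>x. u x * h (t, x) \<partial>M2)"
    and A: "A \<in> sets M2" and A_ge: "1 - 12 * \<eta> / (e / 2)\<^sup>2 \<le> measure M2 A"
    and A_norming: "\<And>L. AE t in M1. norm (\<integral>x. indicator A x *\<^sub>R k (t, x) \<partial>M2) \<le> L \<Longrightarrow> measure M2 A \<le> L"
    using that by (rule perturbed_kernel[OF \<eta>(1) lower half_gt_zero[OF e(1)]])
  have [measurable]: "A \<in> sets \<mu>" using A by simp
  define m where "m = measure M2 A"
  have "12 * \<eta> / (e / 2)\<^sup>2 \<le> e / 4" unfolding \<eta>_def by (rule modulus_estimate[OF e])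
  with A_ge e have m: "1 - e / 4 \<le> m" "0 < m" "m \<le> 1" by (auto simp: m_def)
  have m_eq: "m = (\<integral>x. norm (f0 x) * indicator A x \<partial>\<mu>)"
  proof -
    have "m = (\<integral>x. indicator A x \<partial>M2)" using A by (simp add: m_def)
    also have "\<dots> = (\<integral>x. norm (f0 x) *\<^sub>R indicator A x \<partial>\<mu>)"
      unfolding M2_def by (rule integral_density) auto
    finally show ?thesis by simp
  qed
  have quot: "integrable \<mu> (\<lambda>x. f x / f0 x * f0 x)" if f: "integrable \<mu> f" for f
  proof -
    note [measurable] = borel_measurable_integrable[OF f]
    show ?thesis by (rule Bochner_Integration.integrable_bound[OF f]) auto
  qed
  have q: "integrable M2 (\<lambda>x. f x / f0 x)" "(\<integral>x. norm (f x / f0 x) \<partial>M2) \<le> (\<integral>x. norm (f x) \<partial>\<mu>)"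
    if f: "integrable \<mu> f" for f
  proof -
    note [measurable] = borel_measurable_integrable[OF f]
    note i = quot[OF f]
    then show "integrable M2 (\<lambda>x. f x / f0 x)" by (subst integrable_M2) measurable
    have "(\<integral>x. norm (f x / f0 x) \<partial>M2) = (\<integral>x. norm (f x / f0 x * f0 x) \<partial>\<mu>)"
      by (rule integral_norm_M2) measurable
    also have "\<dots> \<le> (\<integral>x. norm (f x) \<partial>\<mu>)"
      using f i by (intro integral_mono integrable_norm) auto
    finally show "(\<integral>x. norm (f x / f0 x) \<partial>M2) \<le> (\<integral>x. norm (f x) \<partial>\<mu>)" .
  qed
  have space_M1: "space M1 = space \<nu>" by (rule sets_eq_imp_space_eq) simp
  have int: "integrable M2 (\<lambda>x. f x / f0 x * w (t, x))"
    if "integrable \<mu> f" "w \<in> borel_measurable (M1 \<Otimes>\<^sub>M M2)" "\<And>z. norm (w z) \<le> b" "t \<in> space \<nu>"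
    for f w t and b :: real
    by (rule section_integrable[OF that(2,3) q(1)[OF that(1)]]) (simp add: space_M1 that(4))
  \<comment> \<open>Only the difference of the two kernels is added to \<open>\<tau>\<close>: the
    change is visibly small, and \<open>\<sigma>\<close> equals \<open>\<tau>\<close> off
    \<open>B\<close>, where no kernel was constructed.\<close>
  define \<rho> where "\<rho> f t = (\<integral>x. f x / f0 x * (k (t, x) - h (t, x)) \<partial>M2)" for f t
  define \<sigma> where "\<sigma> f t = \<tau> f t + indicator B t *\<^sub>R (\<alpha> t * \<rho> f t)" for f t
  have int_kh: "integrable M2 (\<lambda>x. f x / f0 x * (k (t, x) - h (t, x)))"
    if "integrable \<mu> f" "t \<in> space \<nu>" for f t
    by (rule int[OF that(1) _ kh that(2)]) measurable
  have \<sigma>_measurable: "\<sigma> f \<in> borel_measurable \<nu>" if f: "integrable \<mu> f" for f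
  proof -
    note [measurable] = borel_measurable_integrable[OF f] \<tau>_measurable[OF f]
    have "\<rho> f \<in> borel_measurable M1"
      unfolding \<rho>_def[abs_def] by (rule M2.borel_measurable_lebesgue_integral) measurable
    then have [measurable]: "\<rho> f \<in> borel_measurable \<nu>" by simp
    show ?thesis unfolding \<sigma>_def[abs_def] by measurable
  qed
  have \<sigma>_add: "AE t in \<nu>. \<sigma> (\<lambda>x. f x + g x) t = \<sigma> f t + \<sigma> g t"
    if f: "integrable \<mu> f" and g: "integrable \<mu> g" for f g
    using \<tau>_add[OF f g] AE_space
  proof eventually_elim
    case (elim t)
    have "\<rho> (\<lambda>x. f x + g x) t = \<rho> f t + \<rho> g t"
      unfolding \<rho>_def add_divide_distrib distrib_right[of _ _ "_ - _"]
      by (rule Bochner_Integration.integral_add) (intro int_kh f g elim)+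
    with elim show ?case by (simp add: \<sigma>_def algebra_simps)
  qed
  have \<sigma>_scale: "AE t in \<nu>. \<sigma> (\<lambda>x. c * f x) t = c * \<sigma> f t" if f: "integrable \<mu> f" for c f
    using \<tau>_scale[OF f, of c]
  proof eventually_elim
    case (elim t)
    have "\<rho> (\<lambda>x. c * f x) t = c * \<rho> f t"
      unfolding \<rho>_def by (subst integral_mult_right_zero[symmetric]) (simp add: mult.assoc)
    with elim show ?case by (simp add: \<sigma>_def algebra_simps)
  qed
  have weighted: "norm (\<integral>x. f x / f0 x * w (t, x) \<partial>M2) \<le> b * (\<integral>x. norm (f x / f0 x) \<partial>M2)"
    if f: "integrable \<mu> f" and w: "w \<in> borel_measurable (M1 \<Otimes>\<^sub>M M2)" "\<And>z. norm (w z) \<le> b"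
      and t: "t \<in> space \<nu>" for f w b t
  proof -
    have "norm (\<integral>x. f x / f0 x * w (t, x) \<partial>M2) \<le> (\<integral>x. norm (f x / f0 x * w (t, x)) \<partial>M2)"
      by (rule integral_norm_bound)
    also have "\<dots> \<le> (\<integral>x. b * norm (f x / f0 x) \<partial>M2)"
    proof (rule integral_mono)
      show "integrable M2 (\<lambda>x. norm (f x / f0 x * w (t, x)))"
        by (intro integrable_norm int[OF f w t])
      show "integrable M2 (\<lambda>x. b * norm (f x / f0 x))"
        by (intro integrable_mult_right integrable_norm q(1) f)
      fix x
      show "norm (f x / f0 x * w (t, x)) \<le> b * norm (f x / f0 x)"
        unfolding norm_mult mult.commute[of b] by (intro mult_left_mono w) simp
    qed
    finally show ?thesis by simp
  qed
  have \<sigma>_diff: "AE t in \<nu>. norm (\<sigma> f t - \<tau> f t) \<le> e / 2 * (\<integral>x. norm (f x) \<partial>\<mu>)"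
    if f: "integrable \<mu> f" for f
  proof (rule AE_I2)
    fix t assume t: "t \<in> space \<nu>"
    have "norm (\<rho> f t) \<le> e / 2 * (\<integral>x. norm (f x / f0 x) \<partial>M2)"
      unfolding \<rho>_def by (rule weighted[OF f _ kh t, of "\<lambda>z. z"]) measurable
    also have "\<dots> \<le> e / 2 * (\<integral>x. norm (f x) \<partial>\<mu>)" using e q(2)[OF f] by (intro mult_left_mono) auto
    finally have "norm (\<rho> f t) \<le> e / 2 * (\<integral>x. norm (f x) \<partial>\<mu>)" .
    moreover have "0 \<le> e / 2 * (\<integral>x. norm (f x) \<partial>\<mu>)" using e by simp
    ultimately show "norm (\<sigma> f t - \<tau> f t) \<le> e / 2 * (\<integral>x. norm (f x) \<partial>\<mu>)"
      using \<alpha>_norm[of t] by (cases "t \<in> B") (auto simp: \<sigma>_def norm_mult)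
  qed
  txt \<open>The quotient \<open>f / f0\<close> is \<open>0\<close> where \<open>f0\<close> vanishes; \<open>z f\<close> is the part of \<open>f\<close> lost there.\<close>
  define z :: "('a \<Rightarrow> 'k) \<Rightarrow> 'a \<Rightarrow> 'k" where "z f x = (if f0 x = 0 then f x else 0)" for f x
  have z: "integrable \<mu> (z f)" if f: "integrable \<mu> f" for f
  proof -
    note [measurable] = borel_measurable_integrable[OF f]
    show ?thesis
      by (rule Bochner_Integration.integrable_bound[OF f]) (auto simp: z_def[abs_def])
  qed
  \<comment> \<open>On \<open>B\<close> the contribution of \<open>h\<close> contained in
    \<open>\<tau>\<close> cancels. What remains is \<open>\<tau>\<close> on \<open>z f\<close> and
    the kernel \<open>k\<close> on the rest of \<open>f\<close>, the form in which contractivity can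
    be read off.\<close>
  have \<sigma>_eq: "AE t in \<nu>. t \<in> B \<longrightarrow> \<sigma> f t = \<tau> (z f) t + \<alpha> t * (\<integral>x. f x / f0 x * k (t, x) \<partial>M2)"
    if f: "integrable \<mu> f" for f
  proof -
    note i = quot[OF f]
    have eq: "(\<lambda>x. z f x + f x / f0 x * f0 x) = f" by (auto simp: z_def)
    show ?thesis
      using \<tau>_add[OF z[OF f] i] rep[OF q(1)[OF f], unfolded AE_M1] AE_space
      unfolding eq
    proof eventually_elim
      case (elim t)
      show ?case
      proof
        assume t: "t \<in> B"
        have "\<alpha> t \<noteq> 0" using \<alpha>_norm[OF t] by auto
        then have "\<tau> (\<lambda>x. f x / f0 x * f0 x) t = \<alpha> t * T (\<lambda>x. f x / f0 x) t"
          by (simp add: T_def mult.assoc[symmetric])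
        also have "\<dots> = \<alpha> t * (\<integral>x. f x / f0 x * h (t, x) \<partial>M2)" using elim(2) t by simp
        finally have "\<tau> f t = \<tau> (z f) t + \<alpha> t * (\<integral>x. f x / f0 x * h (t, x) \<partial>M2)" using elim(1) by simp
        moreover have "\<rho> f t = (\<integral>x. f x / f0 x * k (t, x) \<partial>M2) - (\<integral>x. f x / f0 x * h (t, x) \<partial>M2)"
          unfolding \<rho>_def right_diff_distrib
          by (rule Bochner_Integration.integral_diff) (rule int[OF f k k_le elim(3)], rule int[OF f h h_le elim(3)])
        ultimately show "\<sigma> f t = \<tau> (z f) t + \<alpha> t * (\<integral>x. f x / f0 x * k (t, x) \<partial>M2)"
          using t by (simp add: \<sigma>_def right_diff_distrib)
      qed
    qed
  qed
  have \<sigma>_bound: "AE t in \<nu>. norm (\<sigma> f t) \<le> (\<integral>x. norm (f x) \<partial>\<mu>)" if f: "integrable \<mu> f" for f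
    using \<sigma>_eq[OF f] \<tau>_bound[OF f] \<tau>_bound[OF z[OF f]] AE_space
  proof eventually_elim
    case (elim t)
    show ?case
    proof (cases "t \<in> B")
      case True
      have fm [measurable]: "f \<in> borel_measurable \<mu>" using f by auto
      note i = quot[OF f]
      have "norm (\<sigma> f t) \<le> norm (\<tau> (z f) t) + norm (\<integral>x. f x / f0 x * k (t, x) \<partial>M2)"
        using elim(1) True \<alpha>_norm[OF True] norm_triangle_ineq[of "\<tau> (z f) t" "\<alpha> t * (\<integral>x. f x / f0 x * k (t, x) \<partial>M2)"]
        by (simp add: norm_mult)
      also have "\<dots> \<le> (\<integral>x. norm (z f x) \<partial>\<mu>) + 1 * (\<integral>x. norm (f x / f0 x) \<partial>M2)"
        using weighted[OF f k k_le elim(4)] elim(3) by (intro add_mono) auto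
      also have "(\<integral>x. norm (f x / f0 x) \<partial>M2) = (\<integral>x. norm (f x / f0 x * f0 x) \<partial>\<mu>)"
        by (rule integral_norm_M2) measurable
      also have "(\<integral>x. norm (z f x) \<partial>\<mu>) + 1 * \<dots> = (\<integral>x. norm (z f x) + norm (f x / f0 x * f0 x) \<partial>\<mu>)"
        using i z[OF f] by (subst Bochner_Integration.integral_add) auto
      also have "\<dots> = (\<integral>x. norm (f x) \<partial>\<mu>)"
        by (rule Bochner_Integration.integral_cong) (auto simp: z_def)
      finally show ?thesis .
    qed (use elim in \<open>simp add: \<sigma>_def\<close>)
  qed
  define g where "g x = (indicator A x / m) *\<^sub>R f0 x" for x
  have g: "integrable \<mu> g"
  proof -
    have "integrable \<mu> (\<lambda>x. (1 / m) *\<^sub>R (indicator A x *\<^sub>R f0 x))"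
      by (rule integrable_scaleR_right, rule integrable_mult_indicator[OF _ f0(1)]) measurable
    then show ?thesis by (simp add: g_def[abs_def])
  qed
  have fA: "integrable \<mu> (\<lambda>x. norm (f0 x) * indicator A x)"
    by (rule integrable_real_mult_indicator[OF _ integrable_norm[OF f0(1)]]) measurable
  have g_norm: "(\<integral>x. norm (g x) \<partial>\<mu>) = 1"
  proof -
    have "norm (g x) = norm (f0 x) * indicator A x * (1 / m)" for x
      using m by (simp add: g_def indicator_def)
    then show ?thesis using m m_eq by simp
  qed
  have g_close: "(\<integral>x. norm (g x - f0 x) \<partial>\<mu>) < e"
  proof -
    \<comment> \<open>The rescaling on \<open>A\<close> and the deletion off \<open>A\<close> each
      contribute \<open>1 - m\<close> to the distance.\<close>
    have "norm (g x - f0 x) = norm (f0 x) + (1 / m - 2) * (norm (f0 x) * indicator A x)" for x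
    proof (cases "x \<in> A")
      case True
      have "g x - f0 x = (1 / m - 1) *\<^sub>R f0 x" using True by (simp add: g_def scaleR_diff_left)
      moreover have "\<bar>1 / m - 1\<bar> = 1 / m - 1" using m by simp
      ultimately have "norm (g x - f0 x) = (1 / m - 1) * norm (f0 x)" by (simp only: norm_scaleR)
      then show ?thesis using True by (simp add: algebra_simps)
    qed (simp add: g_def)
    then have "(\<integral>x. norm (g x - f0 x) \<partial>\<mu>) = 1 + (1 / m - 2) * m"
      using f0 fA m_eq by simp
    also have "\<dots> = 2 - 2 * m" using m by (simp add: field_simps)
    finally show ?thesis using m e by simp
  qed
  have norming: "1 \<le> L" if L: "AE t in \<nu>. norm (\<sigma> g t) \<le> L" for L
  proof -
    \<comment> \<open>\<open>g\<close> vanishes where \<open>f0\<close> does, so on \<open>B\<close>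
      the value \<open>\<sigma> g\<close> comes from the kernel \<open>k\<close> alone, and
      \<open>A_norming\<close> applies to it.\<close>
    have zg: "z g = (\<lambda>x. 0)" by (auto simp: z_def g_def)
    have ae2: "AE x in M2. g x / f0 x = (1 / m) *\<^sub>R indicator A x *\<^sub>R 1"
      unfolding M2_def by (subst AE_density) (auto simp: g_def indicator_def scaleR_conv_of_real)
    have [measurable]: "g \<in> borel_measurable \<mu>" using g by auto
    have "AE t in M1. norm (\<integral>x. indicator A x *\<^sub>R k (t, x) \<partial>M2) \<le> L * m"
      unfolding AE_M1 using \<sigma>_eq[OF g] \<tau>_bound[OF z[OF g]] L AE_space
    proof eventually_elim
      case (elim t)
      show ?case
      proof
        assume t: "t \<in> B"
        have [measurable]: "t \<in> space M1" using elim(4) by (simp add: space_M1)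
        have "(\<integral>x. g x / f0 x * k (t, x) \<partial>M2) = (\<integral>x. (1 / m) *\<^sub>R (indicator A x *\<^sub>R k (t, x)) \<partial>M2)"
        proof (rule integral_cong_AE)
          show "AE x in M2. g x / f0 x * k (t, x) = (1 / m) *\<^sub>R (indicator A x *\<^sub>R k (t, x))"
            using ae2 by eventually_elim simp
        qed measurable
        also have "\<dots> = (1 / m) *\<^sub>R (\<integral>x. indicator A x *\<^sub>R k (t, x) \<partial>M2)"
          by (rule integral_scaleR_right)
        finally have "norm (\<sigma> g t) = (1 / m) * norm (\<integral>x. indicator A x *\<^sub>R k (t, x) \<partial>M2)"
          using elim(1,2) t \<alpha>_norm[OF t] m by (simp add: zg norm_mult)
        with elim(3) m show "norm (\<integral>x. indicator A x *\<^sub>R k (t, x) \<partial>M2) \<le> L * m"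
          by (simp add: field_simps)
      qed
    qed
    then have "m \<le> L * m" unfolding m_def by (rule A_norming)
    with m show ?thesis by simp
  qed
  show ?thesis
  proof (rule that[OF _ _ g g_norm g_close])
    show "L1_contraction \<nu> \<mu> \<sigma>"
      by (rule L1_contraction.intro) (fact \<sigma>_measurable \<sigma>_add \<sigma>_scale \<sigma>_bound)+
  qed (use \<sigma>_diff norming in blast)+
qed

subsection \<open>Operators on the quotient spaces\<close>

lemma op_norm_le:
  assumes "normed_nspace X" and "\<And>x. x \<in> carr X \<Longrightarrow> vnorm Y (T x) \<le> K * vnorm X x" and "0 \<le> K"
  shows "op_norm X Y T \<le> K"
proof -
  interpret normed_nspace X by fact
  have "vnorm Y (T x) \<le> K" if "x \<in> carr X" "vnorm X x \<le> 1" for x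
    using assms(2)[OF that(1)] mult_left_mono[OF that(2) assms(3)] by simp
  moreover have "vzero X \<in> {x \<in> carr X. vnorm X x \<le> 1}"
    using zero_closed norm_eq_zero[OF zero_closed] by simp
  ultimately show ?thesis
    unfolding op_norm_def by (intro cSUP_least) auto
qed

lemma le_op_norm:
  assumes K: "\<And>x. x \<in> carr X \<Longrightarrow> vnorm Y (T x) \<le> K * vnorm X x"
    and x: "x \<in> carr X" "vnorm X x \<le> 1" and nonneg: "\<And>x. x \<in> carr X \<Longrightarrow> 0 \<le> vnorm X x"
  shows "vnorm Y (T x) \<le> op_norm X Y T"
  unfolding op_norm_def
proof (rule cSUP_upper)
  show "bdd_above ((\<lambda>x. vnorm Y (T x)) ` {x \<in> carr X. vnorm X x \<le> 1})"
  proof (rule bdd_aboveI2)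
    fix y assume y: "y \<in> {x \<in> carr X. vnorm X x \<le> 1}"
    then have "vnorm Y (T y) \<le> K * vnorm X y" using K by simp
    also have "\<dots> \<le> \<bar>K\<bar> * 1" using y nonneg by (intro mult_mono) auto
    finally show "vnorm Y (T y) \<le> \<bar>K\<bar>" by simp
  qed
qed (use x in simp)

lemma bounded_ops_le:
  fixes X :: "('k::real_normed_field, 'v) nspace"
  assumes "normed_nspace X" "normed_nspace Y" and T: "T \<in> bounded_ops X Y" and x: "x \<in> carr X"
  shows "vnorm Y (T x) \<le> op_norm X Y T * vnorm X x"
proof -
  interpret X: normed_nspace X by fact
  interpret Y: normed_nspace Y by fact
  obtain K where K: "\<And>x. x \<in> carr X \<Longrightarrow> vnorm Y (T x) \<le> K * vnorm X x"
    using T unfolding bounded_ops_def by blast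
  have T_closed: "T x \<in> carr Y" and T_scale: "\<And>c. T (vscale X c x) = vscale Y c (T x)"
    using T x unfolding bounded_ops_def by auto
  show ?thesis
  proof (cases "vnorm X x = 0")
    case True
    then show ?thesis using K[OF x] by simp
  next
    case False
    then have pos: "0 < vnorm X x" using X.norm_nonneg[OF x] by simp
    define c :: 'k where "c = of_real (inverse (vnorm X x))"
    have c: "norm c = inverse (vnorm X x)" using pos by (simp add: c_def norm_inverse)
    have "vnorm X (vscale X c x) = 1" using X.norm_scale[OF x, of c] c pos by simp
    then have "vnorm Y (T (vscale X c x)) \<le> op_norm X Y T"
      using X.scale_closed[OF x] X.norm_nonneg by (intro le_op_norm[OF K]) auto
    then show ?thesis
      using Y.norm_scale[OF T_closed, of c] pos by (simp add: T_scale c field_simps)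
  qed
qed

lemma rep_L1:
  fixes M :: "'a measure"
  assumes "A \<in> carr (L1 TYPE('k::{real_normed_field, banach, second_countable_topology}) M)"
  shows "integrable M (rep A)" "ae_class M (rep A) = A"
proof -
  obtain f where f: "integrable M f" and A: "A = ae_class M f"
    using assms by (auto simp: L1_def ae_space_def)
  note r = rep_ae_class[OF borel_measurable_integrable[OF f], folded A]
  show "integrable M (rep A)"
  proof (rule integrable_cong_AE_imp[OF f r(1)])
    show "AE x in M. f x = rep A x" using r(2) by eventually_elim simp
  qed
  show "ae_class M (rep A) = A"
    by (rule trans[OF ae_class_cong[OF r(2)] A[symmetric]])
qed

lemma rep_Linf:
  fixes M :: "'a measure"
  assumes "A \<in> carr (Linf TYPE('k::{real_normed_field, banach, second_countable_topology}) M)"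
  shows "rep A \<in> borel_measurable M" "esssup M (\<lambda>x. ennreal (norm (rep A x))) < \<infinity>" "ae_class M (rep A) = A"
proof -
  obtain f where f: "f \<in> borel_measurable M" "esssup M (\<lambda>x. ennreal (norm (f x))) < \<infinity>"
    and A: "A = ae_class M f"
    using assms by (auto simp: Linf_def ae_space_def)
  note r = rep_ae_class[OF f(1), folded A]
  show "rep A \<in> borel_measurable M" by (rule r)
  have "AE x in M. norm (rep A x) \<le> Linf_norm M f"
    using r(2) Linf_AE_le[OF f(2)] by eventually_elim simp
  then show "esssup M (\<lambda>x. ennreal (norm (rep A x))) < \<infinity>"
    by (rule Linf_I(1)[OF r(1) _ Linf_norm_nonneg])
  show "ae_class M (rep A) = A"
    by (rule trans[OF ae_class_cong[OF r(2)] A[symmetric]])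
qed

text \<open>Transfer from functions to classes. The distances are given in both orders because
  \<open>BPBp\<close> measures from the new pair to the old one and
  \<open>dist_norming_pairs\<close> the other way round.\<close>

lemma norm_attaining_approximation:
  fixes \<mu> :: "'a measure" and \<nu> :: "'b measure"
    and T :: "('a \<Rightarrow> 'k::{real_normed_field, euclidean_space}) set \<Rightarrow> ('b \<Rightarrow> 'k) set"
  defines "X \<equiv> L1 TYPE('k) \<mu>" and "Y \<equiv> Linf TYPE('k) \<nu>"
  assumes semi: "semifinite \<nu>" and e: "0 < e" "e < 1"
    and T: "T \<in> bounded_ops X Y" "op_norm X Y T = 1"
    and x0: "x0 \<in> unit_sphere X" and big: "1 - (e / 10) ^ 8 < vnorm Y (T x0)"
  obtains y S where "y \<in> unit_sphere X" "S \<in> bounded_ops X Y" "op_norm X Y S = 1" "vnorm Y (S y) = 1"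
    "vdist X y x0 < e" "vdist X x0 y < e" "op_dist X Y S T < e" "op_dist X Y T S < e"
proof -
  interpret LX: ae_seminorm \<mu> "{f :: 'a \<Rightarrow> 'k. integrable \<mu> f}" "L1_norm \<mu>"
    by (rule ae_seminorm_L1)
  interpret LY: ae_seminorm \<nu> "{f :: 'b \<Rightarrow> 'k. f \<in> borel_measurable \<nu> \<and> esssup \<nu> (\<lambda>x. ennreal (norm (f x))) < \<infinity>}"
      "Linf_norm \<nu>"
    by (rule ae_seminorm_Linf)
  have X: "X = LX.Q" and Y: "Y = LY.Q" by (simp_all add: X_def Y_def L1_def Linf_def)
  have nX: "normed_nspace X" and nY: "normed_nspace Y" unfolding X Y by (rule LX.normed LY.normed)+
  note TD = T(1)[unfolded bounded_ops_def, simplified]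
  have X_closed: "ae_class \<mu> f \<in> carr X" if "integrable \<mu> f" for f :: "'a \<Rightarrow> 'k"
    using that by (simp add: X LX.carr_Q)
  have X_norm: "vnorm X (ae_class \<mu> f) = (\<integral>x. norm (f x) \<partial>\<mu>)" if "integrable \<mu> f" for f :: "'a \<Rightarrow> 'k"
    using LX.norm_class[of f] that by (simp add: X L1_norm_def)
  define \<tau> where "\<tau> f = rep (T (ae_class \<mu> f))" for f
  have T_closed: "T A \<in> carr (Linf TYPE('k) \<nu>)" if "A \<in> carr X" for A
    using TD that by (auto simp: Y_def)
  have \<tau>_measurable: "\<tau> f \<in> borel_measurable \<nu>" and \<tau>_esssup: "esssup \<nu> (\<lambda>x. ennreal (norm (\<tau> f x))) < \<infinity>"
    and \<tau>_class: "ae_class \<nu> (\<tau> f) = T (ae_class \<mu> f)" if "integrable \<mu> f" for f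
    unfolding \<tau>_def using rep_Linf[OF T_closed[OF X_closed[OF that]]] by auto
  have \<tau>_add: "AE t in \<nu>. \<tau> (\<lambda>x. f x + g x) t = \<tau> f t + \<tau> g t"
    if f: "integrable \<mu> f" and g: "integrable \<mu> g" for f g
  proof -
    note [measurable] = \<tau>_measurable[OF f] \<tau>_measurable[OF g]
    have "T (ae_class \<mu> (\<lambda>x. f x + g x)) = T (vadd X (ae_class \<mu> f) (ae_class \<mu> g))"
      using LX.add_class[of f g] f g by (simp add: X)
    also have "\<dots> = vadd Y (T (ae_class \<mu> f)) (T (ae_class \<mu> g))"
      using TD X_closed f g by simp
    also have "\<dots> = ae_class \<nu> (\<lambda>t. \<tau> f t + \<tau> g t)"
      by (simp add: Y ae_space_def \<tau>_def)
    finally show ?thesis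
      unfolding \<tau>_def[of "\<lambda>x. f x + g x"] by (simp add: rep_ae_class(2))
  qed
  have \<tau>_scale: "AE t in \<nu>. \<tau> (\<lambda>x. c * f x) t = c * \<tau> f t" if f: "integrable \<mu> f" for c f
  proof -
    note [measurable] = \<tau>_measurable[OF f]
    have "T (ae_class \<mu> (\<lambda>x. c * f x)) = T (vscale X c (ae_class \<mu> f))"
      using LX.scale_class[of f c] f by (simp add: X)
    also have "\<dots> = vscale Y c (T (ae_class \<mu> f))"
      using TD X_closed f by simp
    also have "\<dots> = ae_class \<nu> (\<lambda>t. c * \<tau> f t)"
      by (simp add: Y ae_space_def \<tau>_def)
    finally show ?thesis
      unfolding \<tau>_def[of "\<lambda>x. c * f x"] by (simp add: rep_ae_class(2))
  qed
  have norm_T: "vnorm Y (T (ae_class \<mu> f)) = Linf_norm \<nu> (\<tau> f)" for f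
    by (simp add: Y ae_space_def \<tau>_def)
  have \<tau>_bound: "AE t in \<nu>. norm (\<tau> f t) \<le> (\<integral>x. norm (f x) \<partial>\<mu>)" if f: "integrable \<mu> f" for f
  proof -
    have "Linf_norm \<nu> (\<tau> f) \<le> (\<integral>x. norm (f x) \<partial>\<mu>)"
      using bounded_ops_le[OF nX nY T(1) X_closed[OF f]] by (simp add: T(2) X_norm[OF f] norm_T)
    with Linf_AE_le[OF \<tau>_esssup[OF f]] show ?thesis by (auto elim: eventually_mono)
  qed
  define f0 where "f0 = rep x0"
  have x0': "x0 \<in> carr X" "vnorm X x0 = 1" using x0 by (auto simp: unit_sphere_def)
  then have f0: "integrable \<mu> f0" "ae_class \<mu> f0 = x0"
    unfolding f0_def using rep_L1[of x0 \<mu>] by (auto simp: X_def)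
  then have f0_norm: "(\<integral>x. norm (f0 x) \<partial>\<mu>) = 1" using X_norm[OF f0(1)] x0' by simp
  have f0_big: "\<not> (AE t in \<nu>. norm (\<tau> f0 t) \<le> 1 - (e / 10) ^ 8)"
  proof
    assume "AE t in \<nu>. norm (\<tau> f0 t) \<le> 1 - (e / 10) ^ 8"
    moreover have "0 \<le> 1 - (e / 10) ^ 8" using e by (simp add: power_le_one)
    ultimately have "Linf_norm \<nu> (\<tau> f0) \<le> 1 - (e / 10) ^ 8"
      by (rule Linf_I(2)[OF \<tau>_measurable[OF f0(1)]])
    moreover have "vnorm Y (T x0) = Linf_norm \<nu> (\<tau> f0)" using norm_T[of f0] f0(2) by simp
    ultimately show False using big by simp
  qed
  have \<tau>: "L1_contraction \<nu> \<mu> \<tau>"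
    by (rule L1_contraction.intro) (fact \<tau>_measurable \<tau>_add \<tau>_scale \<tau>_bound)+
  obtain \<sigma> g where \<sigma>: "L1_contraction \<nu> \<mu> \<sigma>"
    and \<sigma>_diff: "\<forall>f. integrable \<mu> f \<longrightarrow> (AE t in \<nu>. norm (\<sigma> f t - \<tau> f t) \<le> e / 2 * (\<integral>x. norm (f x) \<partial>\<mu>))"
    and g: "integrable \<mu> g" "(\<integral>x. norm (g x) \<partial>\<mu>) = 1" "(\<integral>x. norm (g x - f0 x) \<partial>\<mu>) < e"
    and norming: "\<forall>L. (AE t in \<nu>. norm (\<sigma> g t) \<le> L) \<longrightarrow> 1 \<le> L"
    by (rule norm_attaining_perturbation[OF semi \<tau> f0(1) f0_norm e f0_big])
  note \<sigma>_measurable = L1_contraction.T_measurable[OF \<sigma>] and \<sigma>_add = L1_contraction.T_add[OF \<sigma>]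
    and \<sigma>_scale = L1_contraction.T_scale[OF \<sigma>] and \<sigma>_bound = L1_contraction.T_bound[OF \<sigma>]
  have \<sigma>_in: "\<sigma> f \<in> borel_measurable \<nu> \<and> esssup \<nu> (\<lambda>x. ennreal (norm (\<sigma> f x))) < \<infinity>"
    and \<sigma>_norm: "Linf_norm \<nu> (\<sigma> f) \<le> (\<integral>x. norm (f x) \<partial>\<mu>)" if f: "integrable \<mu> f" for f
  proof -
    have nonneg: "0 \<le> (\<integral>x. norm (f x) \<partial>\<mu>)" by simp
    note le = Linf_I[OF \<sigma>_measurable[OF f] \<sigma>_bound[OF f] nonneg]
    show "\<sigma> f \<in> borel_measurable \<nu> \<and> esssup \<nu> (\<lambda>x. ennreal (norm (\<sigma> f x))) < \<infinity>"
      by (rule conjI[OF \<sigma>_measurable[OF f] le(1)])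
    show "Linf_norm \<nu> (\<sigma> f) \<le> (\<integral>x. norm (f x) \<partial>\<mu>)" by (rule le(2))
  qed
  define S where "S = (\<lambda>A\<in>carr X. ae_class \<nu> (\<sigma> (rep A)))"
  \<comment> \<open>Independence of the representative: the difference of two representatives has
    norm zero, so \<open>\<sigma>_bound\<close> sends it to zero almost everywhere, and additivity
    does the rest.\<close>
  have S_class: "S (ae_class \<mu> f) = ae_class \<nu> (\<sigma> f)" if f: "integrable \<mu> f" for f
  proof -
    let ?r = "rep (ae_class \<mu> f)"
    have r: "integrable \<mu> ?r" using rep_L1 X_closed[OF f] by (auto simp: X_def)
    have ae: "AE x in \<mu>. ?r x = f x" by (rule rep_ae_class(2)[OF borel_measurable_integrable[OF f]])
    have d: "integrable \<mu> (\<lambda>x. ?r x - f x)" using r f by simp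
    have "(\<integral>x. norm (?r x - f x) \<partial>\<mu>) = (\<integral>x. 0 \<partial>\<mu>)"
      using r f ae by (intro integral_cong_AE) auto
    then have "AE t in \<nu>. \<sigma> (\<lambda>x. ?r x - f x) t = 0"
      using \<sigma>_bound[OF d] by simp
    with \<sigma>_add[OF f d] have "AE t in \<nu>. \<sigma> ?r t = \<sigma> f t"
      by eventually_elim simp
    then show ?thesis using X_closed[OF f] by (simp add: S_def ae_class_cong)
  qed
  have classes: "\<exists>f. integrable \<mu> f \<and> A = ae_class \<mu> f" if "A \<in> carr X" for A
    using that by (auto simp: X LX.carr_Q)
  have S_bound: "vnorm Y (S A) \<le> 1 * vnorm X A" if AX: "A \<in> carr X" for A
  proof -
    obtain f where f: "integrable \<mu> f" and A: "A = ae_class \<mu> f" using classes[OF AX] by blast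
    show ?thesis
      using LY.norm_class[of "\<sigma> f"] \<sigma>_in[OF f] \<sigma>_norm[OF f] by (simp add: A S_class f X_norm Y)
  qed
  have S: "S \<in> bounded_ops X Y"
    unfolding bounded_ops_def
  proof (intro CollectI conjI ballI allI)
    show "S \<in> carr X \<rightarrow>\<^sub>E carr Y"
    proof (rule PiE_I)
      fix A assume "A \<in> carr X"
      then obtain f where f: "integrable \<mu> f" and A: "A = ae_class \<mu> f" using classes by blast
      show "S A \<in> carr Y"
        unfolding A S_class[OF f] Y LY.carr_Q by (rule imageI) (use \<sigma>_in[OF f] in blast)
    qed (simp add: S_def)
    show "\<exists>K. \<forall>A\<in>carr X. vnorm Y (S A) \<le> K * vnorm X A" using S_bound by blast
    fix A assume "A \<in> carr X"
    then obtain f where f: "integrable \<mu> f" and A: "A = ae_class \<mu> f" using classes by blast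
    show "S (vscale X c A) = vscale Y c (S A)" for c
    proof -
      have "S (vscale X c A) = ae_class \<nu> (\<sigma> (\<lambda>x. c * f x))"
        using LX.scale_class[of f c] f by (simp add: A X[symmetric] S_class)
      also have "\<dots> = ae_class \<nu> (\<lambda>t. c * \<sigma> f t)" by (rule ae_class_cong[OF \<sigma>_scale[OF f]])
      also have "\<dots> = vscale Y c (S A)"
        using LY.scale_class[of "\<sigma> f" c] \<sigma>_in[OF f] by (simp add: A S_class f Y)
      finally show ?thesis .
    qed
    fix B assume "B \<in> carr X"
    then obtain v where v: "integrable \<mu> v" and B: "B = ae_class \<mu> v" using classes by blast
    have "S (vadd X A B) = ae_class \<nu> (\<sigma> (\<lambda>x. f x + v x))"
      using LX.add_class[of f v] f v by (simp add: A B X[symmetric] S_class)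
    also have "\<dots> = ae_class \<nu> (\<lambda>t. \<sigma> f t + \<sigma> v t)" by (rule ae_class_cong[OF \<sigma>_add[OF f v]])
    also have "\<dots> = vadd Y (S A) (S B)"
      using LY.add_class[of "\<sigma> f" "\<sigma> v"] \<sigma>_in[OF f] \<sigma>_in[OF v] by (simp add: A B S_class f v Y)
    finally show "S (vadd X A B) = vadd Y (S A) (S B)" .
  qed
  let ?y = "ae_class \<mu> g"
  have y: "?y \<in> carr X" "vnorm X ?y = 1" using X_closed X_norm g by auto
  \<comment> \<open>The norm of \<open>\<sigma> g\<close> is itself a bound almost everywhere, so
    \<open>norming\<close> applies to it.\<close>
  have "1 \<le> Linf_norm \<nu> (\<sigma> g)"
    using \<sigma>_in[OF g(1)] by (intro norming[rule_format] Linf_AE_le) simp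
  then have Sy: "vnorm Y (S ?y) = 1"
    using S_bound[OF y(1)] y(2) LY.norm_class[of "\<sigma> g"] \<sigma>_in[OF g(1)] by (simp add: S_class g Y)
  have "vnorm Y (S ?y) \<le> op_norm X Y S"
    using y by (intro le_op_norm[OF S_bound]) (auto simp: normed_nspace.norm_nonneg[OF nX])
  moreover have "op_norm X Y S \<le> 1"
    by (rule op_norm_le[OF nX S_bound]) auto
  ultimately have S_norm: "op_norm X Y S = 1" using Sy by simp
  have diff: "vnorm Y (vdiff Y (S A) (T A)) \<le> e / 2 * vnorm X A" "vnorm Y (vdiff Y (T A) (S A)) \<le> e / 2 * vnorm X A"
    if AX: "A \<in> carr X" for A
  proof -
    obtain f where f: "integrable \<mu> f" and A: "A = ae_class \<mu> f" using classes[OF AX] by blast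
    have b: "Linf_norm \<nu> (\<lambda>t. \<sigma> f t - \<tau> f t) \<le> e / 2 * (\<integral>x. norm (f x) \<partial>\<mu>)"
      using e \<sigma>_measurable[OF f] \<tau>_measurable[OF f] by (intro Linf_I(2) \<sigma>_diff[rule_format] f) auto
    have FY: "\<sigma> f \<in> {f. f \<in> borel_measurable \<nu> \<and> esssup \<nu> (\<lambda>x. ennreal (norm (f x))) < \<infinity>}"
      "\<tau> f \<in> {f. f \<in> borel_measurable \<nu> \<and> esssup \<nu> (\<lambda>x. ennreal (norm (f x))) < \<infinity>}"
      using \<sigma>_in[OF f] \<tau>_measurable[OF f] \<tau>_esssup[OF f] by auto
    show "vnorm Y (vdiff Y (S A) (T A)) \<le> e / 2 * vnorm X A"
      using LY.dist_class[OF FY] b by (simp add: A S_class f X_norm Y vdist_def flip: \<tau>_class)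
    show "vnorm Y (vdiff Y (T A) (S A)) \<le> e / 2 * vnorm X A"
      using LY.dist_class[OF FY(2,1)] LY.p_diff_commute[OF FY] b
      by (simp add: A S_class f X_norm Y vdist_def flip: \<tau>_class)
  qed
  have dist: "op_dist X Y S T \<le> e / 2" "op_dist X Y T S \<le> e / 2"
    unfolding op_dist_def using e by (intro op_norm_le[OF nX]; simp add: diff[simplified])+
  have "vdist X ?y x0 = (\<integral>x. norm (g x - f0 x) \<partial>\<mu>)" "vdist X x0 ?y = (\<integral>x. norm (f0 x - g x) \<partial>\<mu>)"
    using LX.dist_class[of g f0] LX.dist_class[of f0 g] g(1) f0 by (simp_all add: X L1_norm_def)
  with g(3) have "vdist X ?y x0 < e" "vdist X x0 ?y < e" by (simp_all add: norm_minus_commute)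
  moreover have "op_dist X Y S T < e" "op_dist X Y T S < e" using dist e by linarith+
  ultimately show ?thesis
    using y S S_norm Sy by (intro that[of ?y S]) (auto simp: unit_sphere_def)
qed

section \<open>The property and the bound on its modulus\<close>

lemma BPBp_L1_Linf:
  fixes \<mu> :: "'a measure" and \<nu> :: "'b measure"
  assumes "semifinite \<nu>"
  shows "BPBp (L1 TYPE('k::{real_normed_field, euclidean_space}) \<mu>) (Linf TYPE('k) \<nu>)"
  unfolding BPBp_def
proof (intro allI impI)
  fix e :: real assume e: "0 < e \<and> e < 1"
  let ?X = "L1 TYPE('k) \<mu>" and ?Y = "Linf TYPE('k) \<nu>"
  have "\<exists>y0\<in>unit_sphere ?X. \<exists>S\<in>bounded_ops ?X ?Y. op_norm ?X ?Y S = 1 \<and> vnorm ?Y (S y0) = 1 \<and>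
      vdist ?X y0 x0 < e \<and> op_dist ?X ?Y S T < e"
    if T: "T \<in> bounded_ops ?X ?Y" "op_norm ?X ?Y T = 1" and x0: "x0 \<in> unit_sphere ?X"
      and big: "1 - (e / 10) ^ 8 < vnorm ?Y (T x0)" for T x0
  proof -
    obtain y S where "y \<in> unit_sphere ?X" "S \<in> bounded_ops ?X ?Y" "op_norm ?X ?Y S = 1"
      "vnorm ?Y (S y) = 1" "vdist ?X y x0 < e" "op_dist ?X ?Y S T < e"
      by (rule norm_attaining_approximation[OF assms conjunct1[OF e] conjunct2[OF e] T x0 big])
    then show ?thesis by blast
  qed
  moreover have "0 < (e / 10) ^ 8" using e by simp
  ultimately show "\<exists>\<eta>>0. \<forall>T\<in>bounded_ops ?X ?Y. op_norm ?X ?Y T = 1 \<longrightarrow>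
      (\<forall>x0\<in>unit_sphere ?X. vnorm ?Y (T x0) > 1 - \<eta> \<longrightarrow>
        (\<exists>y0\<in>unit_sphere ?X. \<exists>S\<in>bounded_ops ?X ?Y.
          op_norm ?X ?Y S = 1 \<and> vnorm ?Y (S y0) = 1 \<and> vdist ?X y0 x0 < e \<and> op_dist ?X ?Y S T < e))"
    by blast
qed

text \<open>By contradiction: a value of \<open>1 - vnorm\<close> below the bound would give a
  norming pair with both distances strictly below \<open>e\<close>, against
  \<open>far\<close>.\<close>

lemma BPB_modulus_L1_Linf:
  fixes \<mu> :: "'a measure" and \<nu> :: "'b measure"
  assumes "semifinite \<nu>" and e: "0 < e" "e < 1"
  shows "ereal ((e / 10) ^ 8) \<le> BPB_modulus (L1 TYPE('k::{real_normed_field, euclidean_space}) \<mu>) (Linf TYPE('k) \<nu>) e"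
  unfolding BPB_modulus_def
proof (rule Inf_greatest, clarify)
  fix x T
  assume x: "x \<in> unit_sphere (L1 TYPE('k) \<mu>)"
    and T: "T \<in> bounded_ops (L1 TYPE('k) \<mu>) (Linf TYPE('k) \<nu>)" "op_norm (L1 TYPE('k) \<mu>) (Linf TYPE('k) \<nu>) T = 1"
    and far: "ereal e \<le> dist_norming_pairs (L1 TYPE('k) \<mu>) (Linf TYPE('k) \<nu>) x T"
  show "ereal ((e / 10) ^ 8) \<le> ereal (1 - vnorm (Linf TYPE('k) \<nu>) (T x))"
  proof (rule ccontr)
    assume "\<not> ?thesis"
    then have big: "1 - (e / 10) ^ 8 < vnorm (Linf TYPE('k) \<nu>) (T x)" by simp
    obtain y S where y: "y \<in> unit_sphere (L1 TYPE('k) \<mu>)" and S: "S \<in> bounded_ops (L1 TYPE('k) \<mu>) (Linf TYPE('k) \<nu>)"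
        "op_norm (L1 TYPE('k) \<mu>) (Linf TYPE('k) \<nu>) S = 1" "vnorm (Linf TYPE('k) \<nu>) (S y) = 1"
      and close: "vdist (L1 TYPE('k) \<mu>) x y < e" "op_dist (L1 TYPE('k) \<mu>) (Linf TYPE('k) \<nu>) T S < e"
      by (rule norm_attaining_approximation[OF assms(1) e T x big])
    have "(y, S) \<in> norming_pairs (L1 TYPE('k) \<mu>) (Linf TYPE('k) \<nu>)"
      using y S by (simp add: norming_pairs_def unit_sphere_def)
    then have "dist_norming_pairs (L1 TYPE('k) \<mu>) (Linf TYPE('k) \<nu>) x T
        \<le> ereal (max (vdist (L1 TYPE('k) \<mu>) x y) (op_dist (L1 TYPE('k) \<mu>) (Linf TYPE('k) \<nu>) T S))"
      unfolding dist_norming_pairs_def by (intro INF_lower2[of "(y, S)"]) auto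
    with far have "ereal e \<le> ereal (max (vdist (L1 TYPE('k) \<mu>) x y) (op_dist (L1 TYPE('k) \<mu>) (Linf TYPE('k) \<nu>) T S))"
      by (rule order_trans)
    with close show False by (simp only: ereal_less_eq)
  qed
qed

theorem theorem4p1:
  fixes \<mu> :: "'a measure" and \<nu> :: "'b measure"
  assumes "localizable \<nu>"
  shows "(BPBp (L1 TYPE(real) \<mu>) (Linf TYPE(real) \<nu>) \<and>
          (\<forall>\<epsilon>::real. 0 < \<epsilon> \<and> \<epsilon> < 1 \<longrightarrow>
            BPB_modulus (L1 TYPE(real) \<mu>) (Linf TYPE(real) \<nu>) \<epsilon> \<ge> ereal ((\<epsilon> / 10) ^ 8))) \<and>
         (BPBp (L1 TYPE(complex) \<mu>) (Linf TYPE(complex) \<nu>) \<and>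
          (\<forall>\<epsilon>::real. 0 < \<epsilon> \<and> \<epsilon> < 1 \<longrightarrow>
            BPB_modulus (L1 TYPE(complex) \<mu>) (Linf TYPE(complex) \<nu>) \<epsilon> \<ge> ereal ((\<epsilon> / 10) ^ 8)))"
proof -
  have "semifinite \<nu>" using assms by (simp add: localizable_def)
  \<comment> \<open>Both scalar fields are instances of
    \<open>{real_normed_field, euclidean_space}\<close>, for which the two lemmas are
    proved.\<close>
  then show ?thesis by (auto intro: BPBp_L1_Linf BPB_modulus_L1_Linf)
qed

end
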